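(* Let $L>0$ and let $m,n$ be continuous functions on $[0,L]$, bounded below by some positive constant. For any fixed $t>0$, $$N(\lambda,t,(0,L))=\frac{4\sqrt\lambda}{\pi}\int_0^L\big(m^{-\frac12}+(nt)^{-\frac12}\big)^{-1}dx+o(\sqrt\lambda)\qquad\text{as }\lambda\to\infty.$$
   Context: For a function $u$, $u^\pm=\max\{0,\pm u\}$. For $t>0$, consider the eigenvalue problem $$-u''=\lambda\big(m(x)u^+-t\,n(x)u^-\big)\ \text{ in }(0,L),\qquad u(0)=u(L)=0.$$ Its spectrum is a double sequence $\{\lambda_{k,t}^\pm\}_{k\ge1}$, where for each $k\ge 1$, $\lambda_{k,t}^+$ (resp. $\lambda_{k,t}^-$) is the unique $\lambda>0$ for which the problem has a nontrivial solution with exactly $k$ nodal domains in $(0,L)$ (i.e. $k+1$ zeros in $[0,L]$) and $u'(0)>0$ (resp. $u'(0)<0$). The spectral counting function is $$N(\lambda,t,(0,L))=\#\{k:\lambda_{k,t}^+\le\lambda\}+\#\{k:\lambda_{k,t}^-\le\lambda\}.$$ *)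

theory Defs
  imports "HOL-Analysis.Analysis" "HOL-Library.Landau_Symbols"
begin

definition pos_part :: "real \<Rightarrow> real" where
  "pos_part a = max 0 a"

definition neg_part :: "real \<Rightarrow> real" where
  "neg_part a = max 0 (- a)"

(* u is a classical solution, of class C^1([0,L]) and C^2((0,L)), with derivative du.
   Only the values on [0,L] matter; du 0 and du L are one-sided derivatives, and u'' is
   continuous because the right-hand side is. Weak solutions in H^1_0(0,L) have this
   regularity when m and n are continuous on [0,L]. *)
definition fucik_solution ::
  "real \<Rightarrow> (real \<Rightarrow> real) \<Rightarrow> (real \<Rightarrow> real) \<Rightarrow> real \<Rightarrow> real \<Rightarrow> (real \<Rightarrow> real) \<Rightarrow> (real \<Rightarrow> real) \<Rightarrow> bool"
where
  "fucik_solution L m n t \<mu> u du \<longleftrightarrow>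
     (\<forall>x\<in>{0..L}. (u has_real_derivative du x) (at x within {0..L})) \<and>
     continuous_on {0..L} du \<and>
     (\<forall>x\<in>{0<..<L}. \<exists>ddu. (du has_real_derivative ddu) (at x) \<and>
        - ddu = \<mu> * (m x * pos_part (u x) - t * n x * neg_part (u x))) \<and>
     u 0 = 0 \<and> u L = 0"

definition nodal_domains :: "real \<Rightarrow> (real \<Rightarrow> real) \<Rightarrow> real set set" where
  "nodal_domains L u = components {x \<in> {0<..<L}. u x \<noteq> 0}"

(* k is always at least 1 below, so the condition on card includes finiteness. *)
definition eigval_plus ::
  "real \<Rightarrow> (real \<Rightarrow> real) \<Rightarrow> (real \<Rightarrow> real) \<Rightarrow> real \<Rightarrow> nat \<Rightarrow> real" where
  "eigval_plus L m n t k = (THE \<mu>. \<mu> > 0 \<and>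
     (\<exists>u du. fucik_solution L m n t \<mu> u du \<and> (\<exists>x\<in>{0..L}. u x \<noteq> 0) \<and>
        card (nodal_domains L u) = k \<and> du 0 > 0))"

definition eigval_minus ::
  "real \<Rightarrow> (real \<Rightarrow> real) \<Rightarrow> (real \<Rightarrow> real) \<Rightarrow> real \<Rightarrow> nat \<Rightarrow> real" where
  "eigval_minus L m n t k = (THE \<mu>. \<mu> > 0 \<and>
     (\<exists>u du. fucik_solution L m n t \<mu> u du \<and> (\<exists>x\<in>{0..L}. u x \<noteq> 0) \<and>
        card (nodal_domains L u) = k \<and> du 0 < 0))"

definition counting_fun ::
  "real \<Rightarrow> (real \<Rightarrow> real) \<Rightarrow> (real \<Rightarrow> real) \<Rightarrow> real \<Rightarrow> real \<Rightarrow> nat" where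
  "counting_fun L m n t \<mu> =
     card {k. k \<ge> 1 \<and> eigval_plus L m n t k \<le> \<mu>} +
     card {k. k \<ge> 1 \<and> eigval_minus L m n t k \<le> \<mu>}"

end

theory Submission
  imports Defs
begin

text \<open>
  Put \<open>s = \<surd>\<lambda>\<close> and write a solution in polar form, \<open>u = r sin \<theta>\<close>, \<open>u' = s r cos \<theta>\<close>. The
  positively homogeneous equation separates: the angle obeys a scalar equation of its own,
  \<open>\<theta>' = s (cos\<^sup>2 \<theta> + w sin\<^sup>2 \<theta>)\<close>, where \<open>w\<close> is \<open>m\<close> while \<open>sin \<theta> \<ge> 0\<close> and \<open>t n\<close> while
  \<open>sin \<theta> \<le> 0\<close>. Its right-hand side is positive and Lipschitz in \<open>\<theta>\<close>, so the angle exists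
  globally and increases, and zeros of \<open>u\<close> are its passages through multiples of \<open>\<pi>\<close>. Thus \<open>s\<^sup>2\<close>
  is an eigenvalue with \<open>k\<close> nodal domains exactly if \<open>\<theta>\<close> gains \<open>k \<pi>\<close> over \<open>[0, L]\<close>
  (\<open>eigenfunction_iff\<close>); the sign of \<open>u'(0)\<close> decides between the initial angles \<open>0\<close> and \<open>\<pi>\<close>.
  The total gain is continuous and strictly increasing in \<open>s\<close> and takes all positive values, so
  each eigenvalue exists and is unique, and each half of the counting function is the integer part
  of the gain divided by \<open>\<pi>\<close> (\<open>counting_fun_eq\<close>).

  It remains to find the gain up to \<open>o(s)\<close>, an averaging problem: for large \<open>s\<close> the angle turns
  many times before the coefficients change noticeably. With coefficients frozen at \<open>y\<close>, the upper
  half turn takes time \<open>\<pi> / (s \<surd>m(y))\<close> and the lower one \<open>\<pi> / (s \<surd>(t n(y)))\<close>, so the mean speed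
  is \<open>s H(y)\<close> with \<open>H = 2 (m\<^bsup>-1/2\<^esup> + (t n)\<^bsup>-1/2\<^esup>)\<^bsup>-1\<^esup>\<close>. To compare with the true motion, the
  angle is replaced by \<open>H(y)\<close> times the frozen travel time from \<open>0\<close>: this new variable differs
  from \<open>\<theta>\<close> by at most \<open>2 \<pi>\<close>, and on a short interval starting at \<open>y\<close> its derivative is
  \<open>s H(x)\<close> up to a small multiple of \<open>s\<close>. Besides this, each of the finitely many
  short intervals contributes only a bounded error, so the gain is \<open>s \<integral> H + o(s)\<close>
  (\<open>angle_increment_asymptotics\<close>), for both initial angles.
\<close>

section \<open>Scalar differential inequalities and initial value problems\<close>

text \<open>
  Monotonicity of \<open>exp (- M x) E x - \<delta> x\<close>. With \<open>\<delta> = 0\<close> and \<open>E 0 = 0\<close> this yields uniqueness for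
  initial value problems; with \<open>\<delta> > 0\<close> it yields continuous dependence on a parameter.
\<close>

lemma gronwall:
  fixes E :: "real \<Rightarrow> real"
  assumes cont: "continuous_on {0..L} E"
    and der: "\<And>x. x \<in> {0<..<L} \<Longrightarrow>
      \<exists>E'. (E has_real_derivative E') (at x) \<and> E' \<le> M * E x + \<delta>"
    and "0 \<le> M" "0 \<le> \<delta>" "x \<in> {0..L}"
  shows "E x \<le> exp (M * x) * (E 0 + \<delta> * x)"
proof -
  define f where "f y = exp (- (M * y)) * E y - \<delta> * y" for y
  have "f x \<le> f 0"
  proof (rule DERIV_nonpos_imp_decreasing_open[where f = f and a = 0 and b = x])
    show "0 \<le> x" using assms by simp
    show "continuous_on {0..x} f"
      unfolding f_def using assms(5)
      by (intro continuous_intros continuous_on_subset[OF cont]) auto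
    fix y assume y: "0 < y" "y < x"
    then obtain E' where E': "(E has_real_derivative E') (at y)" "E' \<le> M * E y + \<delta>"
      using der[of y] assms(5) by auto
    have "(f has_real_derivative (exp (- (M * y)) * (E' - M * E y) - \<delta>)) (at y)"
      unfolding f_def
      by (rule derivative_eq_intros E' refl | simp add: algebra_simps)+
    moreover have "exp (- (M * y)) * (E' - M * E y) \<le> 1 * \<delta>"
    proof -
      have "exp (- (M * y)) * (E' - M * E y) \<le> exp (- (M * y)) * \<delta>"
        using E' by (intro mult_left_mono) auto
      also have "\<dots> \<le> 1 * \<delta>"
        using assms y by (intro mult_right_mono) auto
      finally show ?thesis .
    qed
    ultimately show "\<exists>d. (f has_real_derivative d) (at y) \<and> d \<le> 0"
      by (intro exI[of _ "exp (- (M * y)) * (E' - M * E y) - \<delta>"]) simp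
  qed
  then have "exp (- (M * x)) * E x \<le> E 0 + \<delta> * x"
    by (simp add: f_def)
  then have "exp (M * x) * (exp (- (M * x)) * E x) \<le> exp (M * x) * (E 0 + \<delta> * x)"
    by (intro mult_left_mono) auto
  moreover have "exp (M * x) * (exp (- (M * x)) * E x) = E x"
    by (simp add: exp_minus)
  ultimately show ?thesis by simp
qed

text \<open>
  Picard's theorem. In the norm weighted by \<open>exp (- 2 K x)\<close> the integral operator contracts with
  factor \<open>1/2\<close> on the whole of \<open>[0, L]\<close>, so Banach's theorem gives a global solution at once.
  Substituting \<open>\<psi> x = exp (- M x) * y x\<close> moves the weight into the operator, and freezing arguments at the ends of \<open>[0, L]\<close> makes it act on bounded
  continuous functions on the whole line.
\<close>

lemma ivp_global_solution_exists:
  fixes F :: "real \<Rightarrow> real \<Rightarrow> real"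
  assumes "0 < L" "0 < K"
    and contF: "continuous_on ({0..L} \<times> UNIV) (\<lambda>(x, v). F x v)"
    and lip: "\<And>x v w. x \<in> {0..L} \<Longrightarrow> \<bar>F x v - F x w\<bar> \<le> K * \<bar>v - w\<bar>"
  shows "\<exists>y. y 0 = y0 \<and> (\<forall>x\<in>{0..L}. (y has_real_derivative F x (y x)) (at x within {0..L}))"
proof -
  \<comment> \<open>\<open>M\<close> is the rate of the weight, \<open>H \<psi>\<close> the weighted integral operator on \<open>[0, L]\<close>, and \<open>c\<close> the retraction onto it.\<close>
  define M where "M = 2 * K"
  have M: "0 < M" using assms by (simp add: M_def)
  define I where "I \<psi> y = F y (exp (M * y) * \<psi> y)" for \<psi> :: "real \<Rightarrow> real" and y
  define H where "H \<psi> z = exp (- (M * z)) * (y0 + integral {0..z} (I \<psi>))" for \<psi> z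
  define c where "c x = max 0 (min x L)" for x :: real
  have c: "c x \<in> {0..L}" for x using assms by (auto simp: c_def)
  have contI: "continuous_on {0..L} (I \<psi>)" if "continuous_on UNIV \<psi>" for \<psi>
  proof -
    have "continuous_on {0..L} ((\<lambda>(x, v). F x v) \<circ> (\<lambda>y. (y, exp (M * y) * \<psi> y)))"
      by (intro continuous_on_compose continuous_on_subset[OF contF] continuous_intros
          continuous_on_subset[OF that]) auto
    then show ?thesis by (simp add: I_def[abs_def] o_def)
  qed
  have intI: "I \<psi> integrable_on {0..z}" if "continuous_on UNIV \<psi>" "z \<in> {0..L}" for \<psi> z
    using that by (intro integrable_continuous_real continuous_on_subset[OF contI]) auto
  have contH: "continuous_on {0..L} (H \<psi>)" if "continuous_on UNIV \<psi>" for \<psi>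
    unfolding H_def using that
    by (intro continuous_intros indefinite_integral_continuous_1 intI) (use assms in auto)
  define G where "G \<psi> = Bcontfun (\<lambda>x. H (apply_bcontfun \<psi>) (c x))" for \<psi> :: "real \<Rightarrow>\<^sub>C real"
  have G: "apply_bcontfun (G \<psi>) x = H (apply_bcontfun \<psi>) (c x)" for \<psi> x
  proof -
    have "continuous_on UNIV (H (apply_bcontfun \<psi>) \<circ> c)"
      by (intro continuous_on_compose continuous_on_subset[OF contH])
        (use c in \<open>auto simp: c_def intro!: continuous_intros\<close>)
    moreover have "bounded (range (\<lambda>x. H (apply_bcontfun \<psi>) (c x)))"
    proof (rule bounded_subset)
      show "bounded (H (apply_bcontfun \<psi>) ` {0..L})"
        by (intro compact_imp_bounded compact_continuous_image contH) auto
    qed (use c in auto)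
    ultimately have "(\<lambda>x. H (apply_bcontfun \<psi>) (c x)) \<in> bcontfun"
      by (simp add: bcontfun_def o_def)
    then show ?thesis unfolding G_def by (simp add: Bcontfun_inverse)
  qed
  have contr: "dist (G \<psi>) (G \<phi>) \<le> 1/2 * dist \<psi> \<phi>" for \<psi> \<phi>
  proof (rule dist_bound)
    fix x
    define z where "z = c x"
    have z: "z \<in> {0..L}" using c by (simp add: z_def)
    let ?d = "dist \<psi> \<phi>"
    have exp_int: "((\<lambda>y. K * exp (M * y) * ?d) has_integral
        (exp (M * z) * ?d / 2 - exp (M * 0) * ?d / 2)) {0..z}"
      using z by (intro fundamental_theorem_of_calculus)
        (auto intro!: derivative_eq_intros
          simp: has_real_derivative_iff_has_vector_derivative[symmetric] M_def)
    have "\<bar>integral {0..z} (I \<psi>) - integral {0..z} (I \<phi>)\<bar>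
        = norm (integral {0..z} (\<lambda>y. I \<psi> y - I \<phi> y))"
      using z by (subst integral_diff) (auto intro!: intI)
    also have "\<dots> \<le> integral {0..z} (\<lambda>y. K * exp (M * y) * ?d)"
    proof (rule integral_norm_bound_integral)
      show "(\<lambda>y. I \<psi> y - I \<phi> y) integrable_on {0..z}"
        using z by (intro integrable_diff intI) auto
      show "(\<lambda>y. K * exp (M * y) * ?d) integrable_on {0..z}"
        using exp_int by blast
      fix y assume y: "y \<in> {0..z}"
      have "\<bar>\<psi> y - \<phi> y\<bar> \<le> ?d"
        using dist_bounded[of \<psi> y \<phi>] by (simp add: dist_real_def)
      then have le: "exp (M * y) * \<bar>\<psi> y - \<phi> y\<bar> \<le> exp (M * y) * ?d"
        by (intro mult_left_mono) auto
      have "norm (I \<psi> y - I \<phi> y) \<le> K * \<bar>exp (M * y) * \<psi> y - exp (M * y) * \<phi> y\<bar>"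
        unfolding I_def real_norm_def using y z by (intro lip) auto
      also have "\<dots> = K * (exp (M * y) * \<bar>\<psi> y - \<phi> y\<bar>)"
        by (simp add: abs_mult flip: right_diff_distrib)
      also have "\<dots> \<le> K * exp (M * y) * ?d"
        using assms le by simp
      finally show "norm (I \<psi> y - I \<phi> y) \<le> K * exp (M * y) * ?d" .
    qed
    also have "\<dots> = exp (M * z) * ?d / 2 - exp (M * 0) * ?d / 2"
      using exp_int by (rule integral_unique)
    also have "\<dots> \<le> exp (M * z) * ?d / 2" by simp
    finally have le: "\<bar>integral {0..z} (I \<psi>) - integral {0..z} (I \<phi>)\<bar> \<le> exp (M * z) * ?d / 2" .
    have "dist (G \<psi> x) (G \<phi> x)
        = exp (- (M * z)) * \<bar>integral {0..z} (I \<psi>) - integral {0..z} (I \<phi>)\<bar>"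
      by (simp add: G H_def dist_real_def z_def abs_mult flip: right_diff_distrib)
    also have "\<dots> \<le> exp (- (M * z)) * (exp (M * z) * ?d / 2)"
      using le by (intro mult_left_mono) auto
    also have "\<dots> = 1/2 * ?d"
      by (simp add: exp_minus)
    finally show "dist (G \<psi> x) (G \<phi> x) \<le> 1/2 * ?d" .
  qed
  obtain \<psi> where fixpt: "G \<psi> = \<psi>"
    using banach_fix_type[of "1/2" G] contr by auto
  define y where "y x = exp (M * x) * \<psi> x" for x
  have y_eq: "y x = y0 + integral {0..x} (\<lambda>z. F z (y z))" if "x \<in> {0..L}" for x
  proof -
    have "c x = x" using that by (auto simp: c_def)
    then have "\<psi> x = H \<psi> x" using G[of \<psi> x] fixpt by simp
    then show ?thesis by (simp add: y_def H_def I_def[abs_def] exp_minus)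
  qed
  have "(y has_real_derivative F x (y x)) (at x within {0..L})" if x: "x \<in> {0..L}" for x
  proof -
    have "continuous_on {0..L} (\<lambda>z. F z (y z))"
      using contI[of \<psi>] by (simp add: y_def I_def[abs_def])
    then have "((\<lambda>x. y0 + integral {0..x} (\<lambda>z. F z (y z))) has_real_derivative F x (y x))
        (at x within {0..L})"
      using x by (auto intro!: derivative_eq_intros integral_has_real_derivative)
    then show ?thesis
      by (rule has_field_derivative_transform_within[where d = 1]) (use y_eq x in auto)
  qed
  moreover have "y 0 = y0" using y_eq[of 0] assms by simp
  ultimately show ?thesis by blast
qed

text \<open>
  If \<open>d L < 0\<close>, then \<open>d\<close> is negative after its last nonnegative time; there the hypothesis
  reads \<open>d' \<ge> M d\<close>, so \<open>exp (- M x) d x\<close> cannot decrease, a contradiction.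
\<close>

lemma nonneg_if_deriv_ge_neg_abs:
  fixes d :: "real \<Rightarrow> real"
  assumes "0 \<le> L" and cont: "continuous_on {0..L} d" and "0 \<le> d 0"
    and der: "\<And>x. x \<in> {0<..<L} \<Longrightarrow>
      \<exists>d'. (d has_real_derivative d') (at x) \<and> - M * \<bar>d x\<bar> \<le> d'"
  shows "0 \<le> d L"
proof (rule ccontr)
  assume neg: "\<not> 0 \<le> d L"
  define S where "S = {x \<in> {0..L}. 0 \<le> d x}"
  have "closed S"
    unfolding S_def by (intro continuous_on_closed_Collect_le continuous_on_const cont closed_real_atLeastAtMost)
  moreover have "bounded S"
    unfolding S_def by (rule bounded_subset[of "{0..L}"]) auto
  ultimately have "compact S" by (simp add: compact_eq_bounded_closed)
  moreover have "0 \<in> S" using assms by (simp add: S_def)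
  ultimately obtain y where y: "y \<in> S" "\<And>x. x \<in> S \<Longrightarrow> x \<le> y"
    using compact_attains_sup[of S] by auto
  then have "0 \<le> y" "y < L" "0 \<le> d y"
    using neg by (auto simp: S_def order_less_le)
  have dneg: "d x < 0" if "y < x" "x \<le> L" for x
    using y(2)[of x] that \<open>0 \<le> y\<close> by (force simp: S_def)
  define f where "f x = exp (- (M * x)) * d x" for x
  have "f y \<le> f L"
  proof (rule DERIV_nonneg_imp_increasing_open[where f = f and a = y and b = L])
    show "continuous_on {y..L} f"
      unfolding f_def using \<open>0 \<le> y\<close>
      by (intro continuous_intros continuous_on_subset[OF cont]) auto
    fix x assume x: "y < x" "x < L"
    then obtain d' where d': "(d has_real_derivative d') (at x)" "- M * \<bar>d x\<bar> \<le> d'"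
      using der[of x] \<open>0 \<le> y\<close> by auto
    have "(f has_real_derivative (exp (- (M * x)) * (d' - M * d x))) (at x)"
      unfolding f_def
      by (rule derivative_eq_intros d' refl | simp add: algebra_simps)+
    moreover have "0 \<le> exp (- (M * x)) * (d' - M * d x)"
      using d' dneg[of x] x by (intro mult_nonneg_nonneg) auto
    ultimately show "\<exists>e. (f has_real_derivative e) (at x) \<and> 0 \<le> e" by blast
  qed (use \<open>y < L\<close> in simp)
  moreover have "0 \<le> f y" using \<open>0 \<le> d y\<close> by (simp add: f_def)
  moreover have "f L < 0" using neg by (simp add: f_def mult_pos_neg)
  ultimately show False by simp
qed

text \<open>
  The strict form follows by subtracting a line of slope \<open>\<eta>\<close> so small that the margin \<open>\<delta>\<close> absorbs
  both the slope and the change in \<open>M * \<bar>d x\<bar>\<close>.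
\<close>

lemma pos_if_deriv_ge_pos_minus_abs:
  fixes d :: "real \<Rightarrow> real"
  assumes "0 < L" and cont: "continuous_on {0..L} d" and "0 \<le> d 0" and "0 \<le> M" "0 < \<delta>"
    and der: "\<And>x. x \<in> {0<..<L} \<Longrightarrow>
      \<exists>d'. (d has_real_derivative d') (at x) \<and> \<delta> - M * \<bar>d x\<bar> \<le> d'"
  shows "0 < d L"
proof -
  define \<eta> where "\<eta> = \<delta> / (1 + M * L)"
  have pos: "0 < 1 + M * L" using assms by (intro add_pos_nonneg) auto
  have \<eta>: "0 < \<eta>" "\<eta> * (1 + M * L) = \<delta>" using assms pos by (auto simp: \<eta>_def)
  have "0 \<le> d L - \<eta> * L"
  proof (rule nonneg_if_deriv_ge_neg_abs[where d = "\<lambda>x. d x - \<eta> * x" and M = M])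
    show "continuous_on {0..L} (\<lambda>x. d x - \<eta> * x)"
      by (intro continuous_intros cont)
    fix x assume x: "x \<in> {0<..<L}"
    then obtain d' where d': "(d has_real_derivative d') (at x)" "\<delta> - M * \<bar>d x\<bar> \<le> d'"
      using der[of x] by auto
    have "\<eta> * x \<le> \<eta> * L" using x \<eta> by (intro mult_left_mono) auto
    moreover have "0 \<le> \<eta> * x" using x \<eta> by simp
    ultimately have "\<bar>d x\<bar> \<le> \<bar>d x - \<eta> * x\<bar> + \<eta> * L" by linarith
    then have "M * \<bar>d x\<bar> \<le> M * (\<bar>d x - \<eta> * x\<bar> + \<eta> * L)"
      using assms by (intro mult_left_mono) auto
    then have "- M * \<bar>d x - \<eta> * x\<bar> \<le> d' - \<eta>"
      using d' \<eta>(2) by (simp add: algebra_simps)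
    moreover have "((\<lambda>x. d x - \<eta> * x) has_real_derivative d' - \<eta>) (at x)"
      by (rule derivative_eq_intros d' refl | simp)+
    ultimately show "\<exists>d'. ((\<lambda>x. d x - \<eta> * x) has_real_derivative d') (at x)
        \<and> - M * \<bar>d x - \<eta> * x\<bar> \<le> d'" by blast
  qed (use assms in auto)
  then show ?thesis using \<eta> \<open>0 < L\<close> by (smt (verit) mult_pos_pos)
qed

section \<open>The phase equation\<close>

lemma abs_sin_diff_le: "\<bar>sin x - sin y\<bar> \<le> \<bar>x - y\<bar>" for x y :: real
proof -
  have "norm (sin x - sin y) \<le> 1 * norm (x - y)"
    by (rule field_differentiable_bound[of UNIV sin cos]) (auto intro: DERIV_sin)
  then show ?thesis by simp
qed

lemma abs_cos_diff_le: "\<bar>cos x - cos y\<bar> \<le> \<bar>x - y\<bar>" for x y :: real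
  using abs_sin_diff_le[of "pi/2 - x" "pi/2 - y"] by (simp add: sin_diff)

text \<open>
  The bounds \<open>c\<close> and \<open>C\<close> apply to both phases, the coefficient \<open>m\<close> where the solution is positive
  and \<open>t * n\<close> where it is negative.
\<close>

locale two_phase =
  fixes L :: real and m n :: "real \<Rightarrow> real" and t c C :: real
  assumes L_pos: "0 < L" and c_pos: "0 < c"
    and cont_m: "continuous_on {0..L} m" and cont_n: "continuous_on {0..L} n"
    and m_bounds: "\<And>x. x \<in> {0..L} \<Longrightarrow> c \<le> m x \<and> m x \<le> C"
    and n_bounds: "\<And>x. x \<in> {0..L} \<Longrightarrow> c \<le> t * n x \<and> t * n x \<le> C"
begin

definition force :: "real \<Rightarrow> real \<Rightarrow> real" where
  "force x v = m x * pos_part v - t * n x * neg_part v"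

text \<open>
  The product \<open>sin \<theta> * force x (sin \<theta>)\<close> is \<open>m x (sin \<theta>)\<^sup>2\<close> or \<open>t n x (sin \<theta>)\<^sup>2\<close>, according to the sign
  of \<open>sin \<theta>\<close>; thus the speed is positive, and it is Lipschitz in \<open>\<theta>\<close> across the change of phase.
\<close>

definition speed :: "real \<Rightarrow> real \<Rightarrow> real" where
  "speed x \<theta> = (cos \<theta>)\<^sup>2 + sin \<theta> * force x (sin \<theta>)"

lemma C_pos: "0 < C"
  using m_bounds[of 0] c_pos L_pos by force

lemma force_scale:
  assumes "0 \<le> r"
  shows "force x (r * v) = r * force x v"
proof -
  have "pos_part (r * v) = r * pos_part v" "neg_part (r * v) = r * neg_part v"
    using assms by (simp_all add: pos_part_def neg_part_def max_mult_distrib_left)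
  then show ?thesis by (simp add: force_def right_diff_distrib)
qed

lemma force_lipschitz:
  assumes "x \<in> {0..L}"
  shows "\<bar>force x v - force x w\<bar> \<le> 2 * C * \<bar>v - w\<bar>"
proof -
  have "\<bar>m x * (pos_part v - pos_part w)\<bar> \<le> C * \<bar>v - w\<bar>"
    unfolding abs_mult using m_bounds[OF assms] c_pos
    by (intro mult_mono) (auto simp: pos_part_def)
  moreover have "\<bar>t * n x * (neg_part v - neg_part w)\<bar> \<le> C * \<bar>v - w\<bar>"
    unfolding abs_mult[of "t * n x"] using n_bounds[OF assms] c_pos
    by (intro mult_mono) (auto simp: neg_part_def)
  moreover have "force x v - force x w =
      m x * (pos_part v - pos_part w) - t * n x * (neg_part v - neg_part w)"
    by (simp add: force_def algebra_simps)
  ultimately show ?thesis by linarith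
qed

lemma force_0 [simp]: "force x 0 = 0"
  by (simp add: force_def pos_part_def neg_part_def)

lemma force_sign_bounds:
  assumes "x \<in> {0..L}"
  shows "c * v\<^sup>2 \<le> v * force x v" "v * force x v \<le> C * v\<^sup>2"
proof -
  have eq: "v * force x v = (if 0 \<le> v then m x else t * n x) * v\<^sup>2"
    by (simp add: force_def pos_part_def neg_part_def power2_eq_square)
  show "c * v\<^sup>2 \<le> v * force x v" "v * force x v \<le> C * v\<^sup>2"
    unfolding eq using m_bounds[OF assms] n_bounds[OF assms] by (simp_all add: mult_right_mono)
qed

lemma speed_lower: "x \<in> {0..L} \<Longrightarrow> min 1 c \<le> speed x \<theta>"
proof -
  assume "x \<in> {0..L}"
  have "min 1 c * ((cos \<theta>)\<^sup>2 + (sin \<theta>)\<^sup>2) \<le> 1 * (cos \<theta>)\<^sup>2 + c * (sin \<theta>)\<^sup>2"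
    unfolding distrib_left by (intro add_mono mult_right_mono) auto
  then show ?thesis
    using force_sign_bounds(1)[OF \<open>x \<in> {0..L}\<close>, of "sin \<theta>"] by (simp add: speed_def)
qed

lemma speed_pos: "x \<in> {0..L} \<Longrightarrow> 0 < speed x \<theta>"
  using speed_lower[of x \<theta>] c_pos by linarith

lemma speed_upper: "x \<in> {0..L} \<Longrightarrow> speed x \<theta> \<le> 1 + C"
proof -
  assume "x \<in> {0..L}"
  have "(cos \<theta>)\<^sup>2 \<le> 1" "C * (sin \<theta>)\<^sup>2 \<le> C * 1"
    using C_pos by (auto simp: abs_square_le_1 intro!: mult_left_mono)
  then show ?thesis
    using force_sign_bounds(2)[OF \<open>x \<in> {0..L}\<close>, of "sin \<theta>"] by (simp add: speed_def)
qed

lemma speed_lipschitz: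
  assumes x: "x \<in> {0..L}"
  shows "\<bar>speed x v - speed x w\<bar> \<le> (2 + 4 * C) * \<bar>v - w\<bar>"
proof -
  have "\<bar>(cos v - cos w) * (cos v + cos w)\<bar> \<le> \<bar>v - w\<bar> * 2"
    unfolding abs_mult using abs_cos_le_one[of v] abs_cos_le_one[of w]
    by (intro mult_mono abs_cos_diff_le; linarith)
  moreover have "\<bar>(sin v - sin w) * force x (sin v)\<bar> \<le> \<bar>v - w\<bar> * (2 * C)"
  proof -
    have "\<bar>force x (sin v)\<bar> \<le> 2 * C * \<bar>sin v\<bar>"
      using force_lipschitz[OF x, of "sin v" 0] by simp
    also have "\<dots> \<le> 2 * C * 1"
      using C_pos by (intro mult_left_mono) auto
    finally show ?thesis
      unfolding abs_mult using abs_sin_diff_le C_pos by (intro mult_mono) auto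
  qed
  moreover have "\<bar>sin w * (force x (sin v) - force x (sin w))\<bar> \<le> 1 * (2 * C * \<bar>v - w\<bar>)"
  proof -
    have "\<bar>force x (sin v) - force x (sin w)\<bar> \<le> 2 * C * \<bar>sin v - sin w\<bar>"
      by (rule force_lipschitz[OF x])
    also have "\<dots> \<le> 2 * C * \<bar>v - w\<bar>"
      using C_pos abs_sin_diff_le by (intro mult_left_mono) auto
    finally show ?thesis
      unfolding abs_mult using C_pos by (intro mult_mono) auto
  qed
  moreover have "speed x v - speed x w = (cos v - cos w) * (cos v + cos w)
      + (sin v - sin w) * force x (sin v) + sin w * (force x (sin v) - force x (sin w))"
    by (simp add: speed_def algebra_simps power2_eq_square)
  ultimately show ?thesis
    by (simp add: algebra_simps)
qed

lemma continuous_force: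
  assumes "continuous_on S f" "continuous_on S g" "f ` S \<subseteq> {0..L}"
  shows "continuous_on S (\<lambda>z. force (f z) (g z))"
  unfolding force_def pos_part_def neg_part_def
  by (intro continuous_intros continuous_on_compose2[OF cont_m assms(1,3)]
      continuous_on_compose2[OF cont_n assms(1,3)] assms)

lemma continuous_speed:
  fixes f g :: "'a::t2_space \<Rightarrow> real"
  assumes "continuous_on S f" "continuous_on S g" "f ` S \<subseteq> {0..L}"
  shows "continuous_on S (\<lambda>z. speed (f z) (g z))"
  unfolding speed_def
  using assms
  by (intro continuous_on_add continuous_on_power continuous_on_mult continuous_force
      continuous_on_sin continuous_on_cos)

text \<open>
  The Pruefer angle for \<open>\<lambda> = s\<^sup>2\<close>, scaled so that \<open>s\<close> factors out of the right-hand side. The scaling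
  leaves the multiples of \<open>\<pi>\<close> where they are, and it makes monotonicity in \<open>s\<close> evident because
  the speed is bounded below.
\<close>

definition is_angle :: "real \<Rightarrow> real \<Rightarrow> (real \<Rightarrow> real) \<Rightarrow> bool" where
  "is_angle \<alpha> s \<theta> \<longleftrightarrow> \<theta> 0 = \<alpha> \<and>
     (\<forall>x\<in>{0..L}. (\<theta> has_real_derivative s * speed x (\<theta> x)) (at x within {0..L}))"

definition angle :: "real \<Rightarrow> real \<Rightarrow> real \<Rightarrow> real" where
  "angle \<alpha> s = (SOME \<theta>. is_angle \<alpha> s \<theta>)"

context
  fixes \<alpha> s :: real
  assumes s: "0 < s"
begin

lemma is_angle: "is_angle \<alpha> s (angle \<alpha> s)"
proof -
  have "continuous_on ({0..L} \<times> UNIV) (\<lambda>(x, v). s * speed x v)"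
    unfolding case_prod_beta by (intro continuous_intros continuous_speed) auto
  moreover have "\<bar>s * speed x v - s * speed x w\<bar> \<le> s * (2 + 4 * C) * \<bar>v - w\<bar>"
    if "x \<in> {0..L}" for x v w
    using mult_left_mono[OF speed_lipschitz[OF that, of v w], of s] s
    by (simp add: abs_mult mult.assoc flip: right_diff_distrib)
  ultimately have "\<exists>\<theta>. is_angle \<alpha> s \<theta>"
    unfolding is_angle_def using s L_pos C_pos
    by (intro ivp_global_solution_exists[where K = "s * (2 + 4 * C)"]) auto
  then show ?thesis unfolding angle_def by (rule someI_ex)
qed

lemma angle_0: "angle \<alpha> s 0 = \<alpha>"
  using is_angle by (simp add: is_angle_def)

lemma angle_has_derivative_within:
  "x \<in> {0..L} \<Longrightarrow> (angle \<alpha> s has_real_derivative s * speed x (angle \<alpha> s x)) (at x within {0..L})"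
  using is_angle by (simp add: is_angle_def)

lemma angle_has_derivative:
  "x \<in> {0<..<L} \<Longrightarrow> (angle \<alpha> s has_real_derivative s * speed x (angle \<alpha> s x)) (at x)"
  using angle_has_derivative_within[of x] at_within_Icc_at[of 0 x L] by simp

lemma continuous_angle: "continuous_on {0..L} (angle \<alpha> s)"
  using angle_has_derivative_within by (rule DERIV_continuous_on)

text \<open>
  These linear bounds do more than give monotonicity in \<open>x\<close>: they show that the end value ranges from
  its initial value to infinity as \<open>s\<close> does.
\<close>

lemma angle_growth:
  assumes "x \<in> {0..L}" "y \<in> {0..L}" "x \<le> y"
  shows "s * min 1 c * (y - x) \<le> angle \<alpha> s y - angle \<alpha> s x"
    and "angle \<alpha> s y - angle \<alpha> s x \<le> s * (1 + C) * (y - x)"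
proof -
  have cont: "continuous_on {x..y} (angle \<alpha> s)"
    using assms by (intro continuous_on_subset[OF continuous_angle]) auto
  have "angle \<alpha> s x - s * min 1 c * x \<le> angle \<alpha> s y - s * min 1 c * y"
  proof (rule DERIV_nonneg_imp_increasing_open[where f = "\<lambda>z. angle \<alpha> s z - s * min 1 c * z"
        and a = x and b = y])
    fix z assume "x < z" "z < y"
    then have z: "z \<in> {0<..<L}" using assms by auto
    have "((\<lambda>z. angle \<alpha> s z - s * min 1 c * z) has_real_derivative
        s * speed z (angle \<alpha> s z) - s * min 1 c) (at z)"
      by (rule derivative_eq_intros angle_has_derivative z refl | simp)+
    moreover have "0 \<le> s * speed z (angle \<alpha> s z) - s * min 1 c"
      using s z speed_lower[of z "angle \<alpha> s z"] by (simp flip: right_diff_distrib)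
    ultimately show "\<exists>d. ((\<lambda>z. angle \<alpha> s z - s * min 1 c * z) has_real_derivative d) (at z) \<and> 0 \<le> d"
      by blast
  qed (use assms cont in \<open>auto intro!: continuous_intros\<close>)
  then show "s * min 1 c * (y - x) \<le> angle \<alpha> s y - angle \<alpha> s x"
    by (simp add: algebra_simps)
  have "angle \<alpha> s y - s * (1 + C) * y \<le> angle \<alpha> s x - s * (1 + C) * x"
  proof (rule DERIV_nonpos_imp_decreasing_open[where f = "\<lambda>z. angle \<alpha> s z - s * (1 + C) * z"
        and a = x and b = y])
    fix z assume "x < z" "z < y"
    then have z: "z \<in> {0<..<L}" using assms by auto
    have "((\<lambda>z. angle \<alpha> s z - s * (1 + C) * z) has_real_derivative
        s * speed z (angle \<alpha> s z) - s * (1 + C)) (at z)"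
      by (rule derivative_eq_intros angle_has_derivative z refl | simp)+
    moreover have "s * speed z (angle \<alpha> s z) - s * (1 + C) \<le> 0"
      using s z speed_upper[of z "angle \<alpha> s z"]
      by (simp add: mult_le_0_iff flip: right_diff_distrib)
    ultimately show "\<exists>d. ((\<lambda>z. angle \<alpha> s z - s * (1 + C) * z) has_real_derivative d) (at z) \<and> d \<le> 0"
      by blast
  qed (use assms cont in \<open>auto intro!: continuous_intros\<close>)
  then show "angle \<alpha> s y - angle \<alpha> s x \<le> s * (1 + C) * (y - x)"
    by (simp add: algebra_simps)
qed

lemma angle_less:
  assumes "x \<in> {0..L}" "y \<in> {0..L}" "x < y"
  shows "angle \<alpha> s x < angle \<alpha> s y"
proof -
  have "0 < s * min 1 c * (y - x)"
    using assms s c_pos by (intro mult_pos_pos) auto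
  then show ?thesis using angle_growth(1)[of x y] assms by linarith
qed

end

text \<open>
  At equal angles the larger \<open>s\<close> turns faster, by at least \<open>(s2 - s1) * min 1 c\<close>; at different angles
  the Lipschitz bound on the speed limits what can be lost.
\<close>

lemma angle_end_strict_mono:
  assumes "0 < s1" "s1 < s2"
  shows "angle \<alpha> s1 L < angle \<alpha> s2 L"
proof -
  have s2: "0 < s2" using assms by simp
  let ?d = "\<lambda>x. angle \<alpha> s2 x - angle \<alpha> s1 x"
  have "0 < ?d L"
  proof (rule pos_if_deriv_ge_pos_minus_abs[where d = ?d and M = "s1 * (2 + 4 * C)"
        and \<delta> = "(s2 - s1) * min 1 c"])
    show "continuous_on {0..L} ?d"
      using assms s2 by (intro continuous_on_diff continuous_angle)
    fix x assume x: "x \<in> {0<..<L}"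
    then have x': "x \<in> {0..L}" by simp
    let ?v1 = "speed x (angle \<alpha> s1 x)" and ?v2 = "speed x (angle \<alpha> s2 x)"
    have der: "(?d has_real_derivative s2 * ?v2 - s1 * ?v1) (at x)"
      by (intro DERIV_diff angle_has_derivative assms s2 x)
    have "s2 * ?v2 - s1 * ?v1 = (s2 - s1) * ?v2 + s1 * (?v2 - ?v1)"
      by (simp add: algebra_simps)
    moreover have "(s2 - s1) * min 1 c \<le> (s2 - s1) * ?v2"
      using assms speed_lower[OF x'] by (intro mult_left_mono) auto
    moreover have "s1 * \<bar>?v2 - ?v1\<bar> \<le> s1 * ((2 + 4 * C) * \<bar>?d x\<bar>)"
      using assms speed_lipschitz[OF x'] by (intro mult_left_mono) auto
    moreover have "- (s1 * \<bar>?v2 - ?v1\<bar>) \<le> s1 * (?v2 - ?v1)"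
    proof -
      have "s1 * (- \<bar>?v2 - ?v1\<bar>) \<le> s1 * (?v2 - ?v1)"
        using assms by (intro mult_left_mono) auto
      then show ?thesis by (simp only: mult_minus_right)
    qed
    ultimately have "(s2 - s1) * min 1 c - s1 * ((2 + 4 * C) * \<bar>?d x\<bar>) \<le> s2 * ?v2 - s1 * ?v1"
      by linarith
    with der show "\<exists>d'. (?d has_real_derivative d') (at x)
        \<and> (s2 - s1) * min 1 c - s1 * (2 + 4 * C) * \<bar>?d x\<bar> \<le> d'"
      unfolding mult.assoc by blast
  qed (use assms s2 L_pos c_pos C_pos in \<open>auto simp: angle_0\<close>)
  then show ?thesis by simp
qed

text \<open>
  Gronwall's inequality for the squared difference. By \<open>2 a b \<le> a\<^sup>2 + b\<^sup>2\<close> the term caused by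
  \<open>s2 \<noteq> s1\<close> splits into a multiple of the square and a constant.
\<close>

lemma angle_end_diff_le:
  assumes "0 < s1" "0 < s2"
  shows "(angle \<alpha> s2 L - angle \<alpha> s1 L)\<^sup>2
    \<le> exp ((2 * s1 * (2 + 4 * C) + 1) * L) * ((s2 - s1)\<^sup>2 * (1 + C)\<^sup>2 * L)"
proof -
  let ?d = "\<lambda>x. angle \<alpha> s2 x - angle \<alpha> s1 x"
  have "(?d L)\<^sup>2 \<le> exp ((2 * s1 * (2 + 4 * C) + 1) * L) * ((?d 0)\<^sup>2 + (s2 - s1)\<^sup>2 * (1 + C)\<^sup>2 * L)"
  proof (rule gronwall[where E = "\<lambda>x. (?d x)\<^sup>2" and L = L])
    show "continuous_on {0..L} (\<lambda>x. (?d x)\<^sup>2)"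
      using assms by (intro continuous_on_power continuous_on_diff continuous_angle)
    fix x assume x: "x \<in> {0<..<L}"
    then have x': "x \<in> {0..L}" by simp
    let ?v1 = "speed x (angle \<alpha> s1 x)" and ?v2 = "speed x (angle \<alpha> s2 x)"
    have der: "((\<lambda>x. (?d x)\<^sup>2) has_real_derivative 2 * ?d x * (s2 * ?v2 - s1 * ?v1)) (at x)"
      by (rule derivative_eq_intros angle_has_derivative assms x refl | simp)+
    have "2 * ?d x * (s2 * ?v2 - s1 * ?v1)
        = 2 * ?d x * ((s2 - s1) * ?v2) + 2 * s1 * (?d x * (?v2 - ?v1))"
      by (simp add: algebra_simps)
    moreover have "2 * ?d x * ((s2 - s1) * ?v2) \<le> (?d x)\<^sup>2 + ((s2 - s1) * ?v2)\<^sup>2"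
      by (rule sum_squares_bound)
    moreover have "((s2 - s1) * ?v2)\<^sup>2 \<le> (s2 - s1)\<^sup>2 * (1 + C)\<^sup>2"
      unfolding power_mult_distrib using speed_upper[OF x'] speed_pos[OF x'] 
      by (intro mult_left_mono power_mono) (auto intro: less_imp_le)
    moreover have "?d x * (?v2 - ?v1) \<le> (2 + 4 * C) * (?d x)\<^sup>2"
    proof -
      have "?d x * (?v2 - ?v1) \<le> \<bar>?d x\<bar> * \<bar>?v2 - ?v1\<bar>"
        by (metis abs_ge_self abs_mult)
      also have "\<dots> \<le> \<bar>?d x\<bar> * ((2 + 4 * C) * \<bar>?d x\<bar>)"
        using speed_lipschitz[OF x'] by (intro mult_left_mono) auto
      also have "\<dots> = (2 + 4 * C) * (?d x)\<^sup>2"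
        by (simp add: power2_eq_square)
      finally show ?thesis .
    qed
    then have "2 * s1 * (?d x * (?v2 - ?v1)) \<le> 2 * s1 * ((2 + 4 * C) * (?d x)\<^sup>2)"
      using assms by (intro mult_left_mono) auto
    ultimately have "2 * ?d x * (s2 * ?v2 - s1 * ?v1)
        \<le> 2 * s1 * ((2 + 4 * C) * (?d x)\<^sup>2) + (?d x)\<^sup>2 + (s2 - s1)\<^sup>2 * (1 + C)\<^sup>2"
      by linarith
    moreover have "2 * s1 * ((2 + 4 * C) * (?d x)\<^sup>2) + (?d x)\<^sup>2
        = (2 * s1 * (2 + 4 * C) + 1) * (?d x)\<^sup>2"
      unfolding distrib_right[of _ 1] by (simp only: mult.assoc mult_1)
    ultimately show "\<exists>E'. ((\<lambda>x. (?d x)\<^sup>2) has_real_derivative E') (at x)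
        \<and> E' \<le> (2 * s1 * (2 + 4 * C) + 1) * (?d x)\<^sup>2 + (s2 - s1)\<^sup>2 * (1 + C)\<^sup>2"
      using der by auto
  qed (use assms L_pos C_pos in auto)
  then show ?thesis by (simp add: angle_0 assms)
qed

lemma continuous_angle_end: "continuous_on {0<..} (\<lambda>s. angle \<alpha> s L)"
proof (rule continuous_at_imp_continuous_on, intro ballI)
  fix s1 :: real assume "s1 \<in> {0<..}"
  then have s1: "0 < s1" by simp
  let ?b = "\<lambda>s. exp ((2 * s1 * (2 + 4 * C) + 1) * L) * ((s - s1)\<^sup>2 * (1 + C)\<^sup>2 * L)"
  have "((\<lambda>s. (angle \<alpha> s L - angle \<alpha> s1 L)\<^sup>2) \<longlongrightarrow> 0) (at s1)"
  proof (rule tendsto_sandwich[of "\<lambda>_. 0" _ _ ?b])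
    have "(?b \<longlongrightarrow> ?b s1) (at s1)"
      by (intro tendsto_intros)
    then show "(?b \<longlongrightarrow> 0) (at s1)" by simp
    have "eventually (\<lambda>s. 0 < s) (at s1)"
      using s1 by (intro order_tendstoD(1)[OF tendsto_ident_at])
    then show "\<forall>\<^sub>F s in at s1. (angle \<alpha> s L - angle \<alpha> s1 L)\<^sup>2 \<le> ?b s"
      by eventually_elim (rule angle_end_diff_le[OF s1])
  qed auto
  then have "((\<lambda>s. sqrt ((angle \<alpha> s L - angle \<alpha> s1 L)\<^sup>2)) \<longlongrightarrow> sqrt 0) (at s1)"
    by (rule tendsto_real_sqrt)
  then have "((\<lambda>s. \<bar>angle \<alpha> s L - angle \<alpha> s1 L\<bar>) \<longlongrightarrow> 0) (at s1)"
    by simp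
  then show "isCont (\<lambda>s. angle \<alpha> s L) s1"
    unfolding isCont_def by (rule LIM_zero_cancel[OF tendsto_rabs_zero_cancel])
qed

lemma angle_end_attains:
  assumes "\<alpha> < \<beta>"
  shows "\<exists>s>0. angle \<alpha> s L = \<beta>"
proof -
  define s1 where "s1 = (\<beta> - \<alpha>) / ((1 + C) * L)"
  define s2 where "s2 = max s1 ((\<beta> - \<alpha>) / (min 1 c * L))"
  have s1: "0 < s1" using assms C_pos L_pos by (simp add: s1_def)
  have s2: "s1 \<le> s2" "0 < s2" using s1 by (auto simp: s2_def)
  have "angle \<alpha> s1 L \<le> \<beta>"
  proof -
    have "s1 * (1 + C) * L = \<beta> - \<alpha>"
      using C_pos L_pos by (simp add: s1_def)
    then show ?thesis
      using angle_growth(2)[OF s1, of 0 L \<alpha>] L_pos by (simp add: angle_0[OF s1])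
  qed
  moreover have "\<beta> \<le> angle \<alpha> s2 L"
  proof -
    have "\<beta> - \<alpha> = (\<beta> - \<alpha>) / (min 1 c * L) * (min 1 c * L)"
      using c_pos L_pos by simp
    also have "\<dots> \<le> s2 * (min 1 c * L)"
      using c_pos L_pos by (intro mult_right_mono) (auto simp: s2_def)
    finally show ?thesis
      using angle_growth(1)[OF s2(2), of 0 L \<alpha>] L_pos by (simp add: angle_0[OF s2(2)] mult.assoc)
  qed
  moreover have "continuous_on {s1..s2} (\<lambda>s. angle \<alpha> s L)"
    using s1 by (intro continuous_on_subset[OF continuous_angle_end]) auto
  ultimately obtain s where s: "s1 \<le> s" "s \<le> s2" "angle \<alpha> s L = \<beta>"
    using IVT'[of "\<lambda>s. angle \<alpha> s L" s1 \<beta> s2] s2 by auto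
  then have "0 < s" using s1 by simp
  with s show ?thesis by blast
qed

end

section \<open>Solutions in polar form, nodal domains and eigenvalues\<close>

text \<open>
  The components are the preimages of the intervals between consecutive multiples of \<open>\<pi>\<close>: by
  monotonicity these are intervals, and by the intermediate value theorem none is empty.
\<close>

lemma card_components_sin_nonzero:
  fixes \<theta> :: "real \<Rightarrow> real" and j k :: nat
  assumes L: "0 < L" and cont: "continuous_on {0..L} \<theta>"
    and mono: "\<And>x y. x \<in> {0..L} \<Longrightarrow> y \<in> {0..L} \<Longrightarrow> x < y \<Longrightarrow> \<theta> x < \<theta> y"
    and \<theta>0: "\<theta> 0 = j * pi" and \<theta>L: "\<theta> L = (j + k) * pi"
  shows "card (components {x \<in> {0<..<L}. sin (\<theta> x) \<noteq> 0}) = k"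
proof -
  define A where "A i = {x \<in> {0<..<L}. \<theta> x \<in> {(j + i) * pi<..<(j + i + 1) * pi}}" for i :: nat
  have monole: "\<theta> x \<le> \<theta> y" if "x \<in> {0..L}" "y \<in> {0..L}" "x \<le> y" for x y
    using mono[of x y] that by (cases "x = y") auto
  have contA: "continuous_on {0<..<L} \<theta>"
    by (rule continuous_on_subset[OF cont]) auto
  have openA: "open (A i)" for i
  proof -
    have "A i = {0<..<L} \<inter> \<theta> -` {(j + i) * pi<..<(j + i + 1) * pi}"
      by (auto simp: A_def)
    then show ?thesis using continuous_open_preimage[OF contA] by simp
  qed
  have connA: "connected (A i)" for i
  proof -
    have "is_interval (A i)"
      unfolding is_interval_1
    proof (intro ballI allI impI)
      fix x z y assume xz: "x \<in> A i" "z \<in> A i" and y: "x \<le> y \<and> y \<le> z"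
      then have "\<theta> x \<le> \<theta> y" "\<theta> y \<le> \<theta> z" by (auto simp: A_def intro!: monole)
      with xz y show "y \<in> A i" by (auto simp: A_def)
    qed
    then show ?thesis by (simp add: is_interval_connected_1)
  qed
  have neA: "A i \<noteq> {}" if "i < k" for i
  proof -
    have ends: "\<theta> 0 < (j + i + 1/2) * pi" "(j + i + 1/2) * pi < \<theta> L"
      unfolding \<theta>0 \<theta>L using that by (auto intro!: mult_strict_right_mono)
    then obtain x where x: "0 \<le> x" "x \<le> L" "\<theta> x = (j + i + 1/2) * pi"
      using IVT'[OF _ _ _ cont, of "(j + i + 1/2) * pi"] L by auto
    have "x \<noteq> 0" "x \<noteq> L"
      using x(3) ends by auto
    then have "x \<in> A i"
      using x by (auto simp: A_def intro!: mult_strict_right_mono)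
    then show ?thesis by blast
  qed
  have disjA: "i = i'" if "x \<in> A i" "x \<in> A i'" for i i' x
  proof -
    have "(j + i) * pi < \<theta> x" "\<theta> x < (j + i + 1) * pi"
        "(j + i') * pi < \<theta> x" "\<theta> x < (j + i' + 1) * pi"
      using that by (simp_all add: A_def)
    then have "(j + i) * pi < (j + i' + 1) * pi" "(j + i') * pi < (j + i + 1) * pi"
      by linarith+
    then have "real i < real i' + 1" "real i' < real i + 1"
      by (simp_all add: mult_less_cancel_right)
    then show ?thesis by linarith
  qed
  have "components {x \<in> {0<..<L}. sin (\<theta> x) \<noteq> 0} = A ` {..<k}"
  proof (rule components_open_unique)
    show "pairwise disjnt (A ` {..<k})"
      using disjA by (auto simp: pairwise_def disjnt_def)
    show "open X \<and> connected X \<and> X \<noteq> {}" if "X \<in> A ` {..<k}" for X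
      using that openA connA neA by auto
    show "\<Union> (A ` {..<k}) = {x \<in> {0<..<L}. sin (\<theta> x) \<noteq> 0}"
    proof (intro equalityI subsetI)
      fix x assume "x \<in> \<Union> (A ` {..<k})"
      then obtain i where x: "x \<in> A i" by auto
      have "sin (\<theta> x) \<noteq> 0"
      proof
        assume "sin (\<theta> x) = 0"
        then obtain q :: int where q: "\<theta> x = q * pi" by (auto simp: sin_zero_iff_int2)
        with x have "(j + i) * pi < q * pi" "q * pi < (j + i + 1) * pi"
          by (auto simp: A_def)
        then have "real j + real i < of_int q" "of_int q < real j + real i + 1"
          by (simp_all add: mult_less_cancel_right)
        then have "int (j + i) < q" "q < int (j + i) + 1"
          using of_int_less_iff[of "int (j + i)" q, where 'a = real]
            of_int_less_iff[of q "int (j + i) + 1", where 'a = real] by simp_all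
        then show False by linarith
      qed
      with x show "x \<in> {x \<in> {0<..<L}. sin (\<theta> x) \<noteq> 0}" by (auto simp: A_def)
    next
      fix x assume x: "x \<in> {x \<in> {0<..<L}. sin (\<theta> x) \<noteq> 0}"
      define q where "q = \<lfloor>\<theta> x / pi\<rfloor>"
      have "\<theta> 0 < \<theta> x" "\<theta> x < \<theta> L" using x by (auto intro!: mono)
      then have bnd: "real j < \<theta> x / pi" "\<theta> x / pi < real (j + k)"
        unfolding \<theta>0 \<theta>L by (auto simp: field_simps)
      have q: "of_int q \<le> \<theta> x / pi" "\<theta> x / pi < of_int q + 1"
        by (simp_all add: q_def)
      have "\<theta> x \<noteq> of_int q * pi" using x by (auto simp: sin_zero_iff_int2)
      then have q1: "of_int q < \<theta> x / pi" using q by (auto simp: field_simps less_le)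
      have jq: "int j \<le> q" "q < int (j + k)"
        using bnd by (simp_all add: q_def le_floor_iff floor_less_iff)
      define i where "i = nat (q - int j)"
      have i: "q = int (j + i)" "i < k" using jq by (simp_all add: i_def)
      have "x \<in> A i" using x q1 q(2) i by (auto simp: A_def field_simps)
      with i show "x \<in> \<Union> (A ` {..<k})" by blast
    qed
  qed
  moreover have "inj_on A {..<k}"
    using neA disjA by (force simp: inj_on_def)
  ultimately show ?thesis by (simp add: card_image)
qed

context two_phase
begin

definition is_solution :: "real \<Rightarrow> (real \<Rightarrow> real) \<Rightarrow> (real \<Rightarrow> real) \<Rightarrow> bool" where
  "is_solution s u du \<longleftrightarrow>
     (\<forall>x\<in>{0..L}. (u has_real_derivative du x) (at x within {0..L})) \<and>
     continuous_on {0..L} du \<and>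
     (\<forall>x\<in>{0<..<L}. (du has_real_derivative - s\<^sup>2 * force x (u x)) (at x))"

lemma fucik_solution_iff:
  "fucik_solution L m n t (s\<^sup>2) u du \<longleftrightarrow> is_solution s u du \<and> u 0 = 0 \<and> u L = 0"
proof -
  have "(\<exists>ddu. (du has_real_derivative ddu) (at x) \<and>
      - ddu = s\<^sup>2 * (m x * pos_part (u x) - t * n x * neg_part (u x))) \<longleftrightarrow>
      (du has_real_derivative - s\<^sup>2 * force x (u x)) (at x)" for x
    unfolding force_def by (metis minus_equation_iff minus_mult_left)
  then show ?thesis by (auto simp: fucik_solution_def is_solution_def)
qed

lemma is_solution_scale:
  assumes "is_solution s u du" "0 \<le> a"
  shows "is_solution s (\<lambda>x. a * u x) (\<lambda>x. a * du x)"
proof -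
  have "((\<lambda>x. a * u x) has_real_derivative a * du x) (at x within {0..L})" if "x \<in> {0..L}" for x
    using assms that unfolding is_solution_def by (intro DERIV_cmult) auto
  moreover have "continuous_on {0..L} (\<lambda>x. a * du x)"
    using assms unfolding is_solution_def by (intro continuous_on_mult continuous_on_const) auto
  moreover have "((\<lambda>x. a * du x) has_real_derivative - s\<^sup>2 * force x (a * u x)) (at x)"
    if "x \<in> {0<..<L}" for x
  proof -
    have "(du has_real_derivative - s\<^sup>2 * force x (u x)) (at x)"
      using assms that unfolding is_solution_def by auto
    then have "((\<lambda>x. a * du x) has_real_derivative a * (- s\<^sup>2 * force x (u x))) (at x)"
      by (rule DERIV_cmult)
    moreover have "a * (- s\<^sup>2 * force x (u x)) = - s\<^sup>2 * force x (a * u x)"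
      by (simp add: force_scale[OF assms(2)])
    ultimately show ?thesis by (simp only:)
  qed
  ultimately show ?thesis unfolding is_solution_def by blast
qed

text \<open>
  The force is Lipschitz, so the energy of the difference of two solutions satisfies \<open>E' \<le> const E\<close>.
\<close>

lemma solution_unique:
  assumes sol: "is_solution s u1 du1" "is_solution s u2 du2"
    and init: "u1 0 = u2 0" "du1 0 = du2 0" and x: "x \<in> {0..L}"
  shows "u1 x = u2 x"
proof -
  define E where "E x = (u1 x - u2 x)\<^sup>2 + (du1 x - du2 x)\<^sup>2" for x
  have contu: "continuous_on {0..L} u1" "continuous_on {0..L} u2"
    using sol unfolding is_solution_def by (blast intro: DERIV_continuous_on)+
  have "E x \<le> exp ((1 + s\<^sup>2 * (2 * C)) * x) * (E 0 + 0 * x)"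
  proof (rule gronwall[OF _ _ _ _ x])
    show "continuous_on {0..L} E"
      unfolding E_def using sol contu unfolding is_solution_def
      by (intro continuous_on_add continuous_on_power continuous_on_diff) auto
    fix y assume y: "y \<in> {0<..<L}"
    let ?p = "u1 y - u2 y" and ?q = "du1 y - du2 y"
    let ?f = "force y (u1 y) - force y (u2 y)"
    have d: "(u1 has_real_derivative du1 y) (at y)" "(u2 has_real_derivative du2 y) (at y)"
        "(du1 has_real_derivative - s\<^sup>2 * force y (u1 y)) (at y)"
        "(du2 has_real_derivative - s\<^sup>2 * force y (u2 y)) (at y)"
      using sol y at_within_Icc_at[of 0 y L] unfolding is_solution_def
      by (metis greaterThanLessThan_subseteq_atLeastAtMost_iff greaterThanLessThan_iff
          atLeastAtMost_iff less_imp_le)+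
    have "(E has_real_derivative (2 * ?p * ?q + 2 * ?q * (- s\<^sup>2 * ?f))) (at y)"
      unfolding E_def
      by (rule derivative_eq_intros d refl | simp add: algebra_simps)+
    moreover have "2 * ?p * ?q + 2 * ?q * (- s\<^sup>2 * ?f) \<le> (1 + s\<^sup>2 * (2 * C)) * E y + 0"
    proof -
      have pq: "2 * \<bar>?p\<bar> * \<bar>?q\<bar> \<le> E y"
        using sum_squares_bound[of "\<bar>?p\<bar>" "\<bar>?q\<bar>"] by (simp add: E_def)
      have "\<bar>?q\<bar> * \<bar>?f\<bar> \<le> \<bar>?q\<bar> * (2 * C * \<bar>?p\<bar>)"
        using y by (intro mult_left_mono force_lipschitz) auto
      also have "\<dots> = C * (2 * \<bar>?p\<bar> * \<bar>?q\<bar>)" by simp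
      also have "\<dots> \<le> C * E y" using pq C_pos by (intro mult_left_mono) auto
      finally have "s\<^sup>2 * (\<bar>?q\<bar> * \<bar>?f\<bar>) \<le> s\<^sup>2 * (C * E y)"
        by (intro mult_left_mono) auto
      moreover have "?q * (- s\<^sup>2 * ?f) \<le> s\<^sup>2 * (\<bar>?q\<bar> * \<bar>?f\<bar>)"
      proof -
        have "?q * (- s\<^sup>2 * ?f) \<le> \<bar>?q * (- s\<^sup>2 * ?f)\<bar>" by (rule abs_ge_self)
        also have "\<dots> = s\<^sup>2 * (\<bar>?q\<bar> * \<bar>?f\<bar>)" by (simp add: abs_mult)
        finally show ?thesis .
      qed
      moreover have "?p * ?q \<le> \<bar>?p\<bar> * \<bar>?q\<bar>" by (metis abs_ge_self abs_mult)
      ultimately have "2 * ?p * ?q + 2 * ?q * (- s\<^sup>2 * ?f) \<le> E y + 2 * (s\<^sup>2 * (C * E y))"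
        using pq by linarith
      also have "\<dots> = (1 + s\<^sup>2 * (2 * C)) * E y + 0" by (simp add: distrib_right)
      finally show ?thesis .
    qed
    ultimately show "\<exists>E'. (E has_real_derivative E') (at y)
        \<and> E' \<le> (1 + s\<^sup>2 * (2 * C)) * E y + 0" by blast
  qed (use C_pos in auto)
  then have "E x \<le> 0" by (simp add: E_def init)
  moreover have "(u1 x - u2 x)\<^sup>2 \<le> E x" by (simp add: E_def)
  ultimately have "(u1 x - u2 x)\<^sup>2 \<le> 0" by linarith
  then show ?thesis by simp
qed

text \<open>
  The amplitude obeys the linear equation \<open>r' = r s cos \<theta> (sin \<theta> - force x (sin \<theta>))\<close>, obtained by
  eliminating \<open>\<theta>'\<close> from \<open>(r sin \<theta>)' = s r cos \<theta>\<close>. Written as an exponential it never vanishes, so zeros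
  of \<open>r sin \<theta>\<close> are zeros of \<open>sin \<theta>\<close>.
\<close>

definition radius :: "real \<Rightarrow> real \<Rightarrow> real \<Rightarrow> real" where
  "radius \<alpha> s x = exp (integral {0..x} (\<lambda>y. s * cos (angle \<alpha> s y)
     * (sin (angle \<alpha> s y) - force y (sin (angle \<alpha> s y)))))"

lemma radius_pos: "0 < radius \<alpha> s x"
  by (simp add: radius_def)

lemma radius_0: "radius \<alpha> s 0 = 1"
  by (simp add: radius_def)

lemma radius_has_derivative:
  assumes "0 < s" "x \<in> {0..L}"
  shows "(radius \<alpha> s has_real_derivative radius \<alpha> s x * (s * cos (angle \<alpha> s x)
     * (sin (angle \<alpha> s x) - force x (sin (angle \<alpha> s x))))) (at x within {0..L})"
proof -
  have "continuous_on {0..L} (\<lambda>y. s * cos (angle \<alpha> s y)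
     * (sin (angle \<alpha> s y) - force y (sin (angle \<alpha> s y))))"
    using assms by (intro continuous_on_mult continuous_on_const continuous_on_diff continuous_on_cos
      continuous_on_sin continuous_force continuous_angle continuous_on_id) auto
  from integral_has_real_derivative[OF this assms(2)]
  show ?thesis unfolding radius_def[abs_def]
    by (rule DERIV_chain2[OF DERIV_exp])
qed

lemma polar_is_solution:
  assumes s: "0 < s"
  shows "is_solution s (\<lambda>x. radius \<alpha> s x * sin (angle \<alpha> s x)) (\<lambda>x. s * (radius \<alpha> s x * cos (angle \<alpha> s x)))"
proof -
  let ?r = "radius \<alpha> s" and ?\<theta> = "angle \<alpha> s"
  let ?g = "\<lambda>x. force x (sin (?\<theta> x))"
  let ?r' = "\<lambda>x. ?r x * (s * cos (?\<theta> x) * (sin (?\<theta> x) - ?g x))"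
  let ?\<theta>' = "\<lambda>x. s * speed x (?\<theta> x)"
  have u: "((\<lambda>x. ?r x * sin (?\<theta> x)) has_real_derivative s * (?r x * cos (?\<theta> x))) (at x within {0..L})"
    if x: "x \<in> {0..L}" for x
  proof -
    have "((\<lambda>x. ?r x * sin (?\<theta> x)) has_real_derivative
        ?r' x * sin (?\<theta> x) + (cos (?\<theta> x) * ?\<theta>' x) * ?r x) (at x within {0..L})"
      by (intro DERIV_mult DERIV_chain2[OF DERIV_sin] radius_has_derivative angle_has_derivative_within s x)
    moreover have "?r' x * sin (?\<theta> x) + (cos (?\<theta> x) * ?\<theta>' x) * ?r x
        = s * (?r x * cos (?\<theta> x)) * ((sin (?\<theta> x))\<^sup>2 + (cos (?\<theta> x))\<^sup>2)"
      unfolding speed_def by algebra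
    ultimately show ?thesis by simp
  qed
  have du: "((\<lambda>x. s * (?r x * cos (?\<theta> x))) has_real_derivative - s\<^sup>2 * force x (?r x * sin (?\<theta> x)))
      (at x within {0..L})" if x: "x \<in> {0..L}" for x
  proof -
    have "((\<lambda>x. s * (?r x * cos (?\<theta> x))) has_real_derivative
        s * (?r' x * cos (?\<theta> x) + (- sin (?\<theta> x) * ?\<theta>' x) * ?r x)) (at x within {0..L})"
      by (intro DERIV_cmult DERIV_mult DERIV_chain2[OF DERIV_cos] radius_has_derivative
          angle_has_derivative_within s x)
    moreover have "s * (?r' x * cos (?\<theta> x) + (- sin (?\<theta> x) * ?\<theta>' x) * ?r x)
        = - s\<^sup>2 * (?r x * ?g x) * ((sin (?\<theta> x))\<^sup>2 + (cos (?\<theta> x))\<^sup>2)"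
      unfolding speed_def by algebra
    ultimately show ?thesis
      using force_scale[of "?r x" x "sin (?\<theta> x)"] radius_pos[of \<alpha> s x] by simp
  qed
  show ?thesis unfolding is_solution_def
  proof (intro conjI ballI u)
    show "continuous_on {0..L} (\<lambda>x. s * (?r x * cos (?\<theta> x)))"
      using du by (rule DERIV_continuous_on)
    fix x assume "x \<in> {0<..<L}"
    then show "((\<lambda>x. s * (?r x * cos (?\<theta> x))) has_real_derivative
        - s\<^sup>2 * force x (?r x * sin (?\<theta> x))) (at x)"
      using du[of x] at_within_Icc_at[of 0 x L] by simp
  qed auto
qed

lemma card_nodal_domains_polar:
  assumes s: "0 < s" and fin: "angle (real j * pi) s L = real (j + k) * pi"
    and u: "\<And>x. x \<in> {0..L} \<Longrightarrow> u x = a * (radius (real j * pi) s x * sin (angle (real j * pi) s x))"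
    and a: "a \<noteq> 0"
  shows "card (nodal_domains L u) = k"
proof -
  let ?\<theta> = "angle (real j * pi) s"
  have "{x \<in> {0<..<L}. u x \<noteq> 0} = {x \<in> {0<..<L}. sin (?\<theta> x) \<noteq> 0}"
  proof (intro Collect_cong conj_cong refl)
    fix x assume "x \<in> {0<..<L}"
    then show "u x \<noteq> 0 \<longleftrightarrow> sin (?\<theta> x) \<noteq> 0"
      using u[of x] a radius_pos[of "real j * pi" s x] by auto
  qed
  moreover have "card (components {x \<in> {0<..<L}. sin (?\<theta> x) \<noteq> 0}) = k"
    using fin by (intro card_components_sin_nonzero[where j = j] L_pos continuous_angle angle_less s)
      (auto simp: angle_0[OF s])
  ultimately show ?thesis by (simp add: nodal_domains_def)
qed

text \<open>
  By uniqueness and positive homogeneity, every solution with \<open>u 0 = 0\<close> and \<open>u'(0)\<close> of the sign of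
  \<open>cos (j \<pi>)\<close> is a positive multiple of the polar solution that starts at the angle \<open>j \<pi>\<close>. The
  boundary condition at \<open>L\<close> then says that the final angle is a multiple of \<open>\<pi>\<close>, and the number
  of nodal domains says which one. The cases \<open>j = 0\<close> and \<open>j = 1\<close> are the two families of eigenvalues.
\<close>

lemma eigenfunction_iff:
  assumes s: "0 < s" and k: "1 \<le> k"
  shows "(\<exists>u du. fucik_solution L m n t (s\<^sup>2) u du \<and> (\<exists>x\<in>{0..L}. u x \<noteq> 0) \<and>
      card (nodal_domains L u) = k \<and> 0 < cos (real j * pi) * du 0)
    \<longleftrightarrow> angle (real j * pi) s L = real (j + k) * pi" (is "?E \<longleftrightarrow> ?A")
proof -
  let ?\<alpha> = "real j * pi"
  let ?\<theta> = "angle ?\<alpha> s" and ?r = "radius ?\<alpha> s"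
  let ?v = "\<lambda>x. ?r x * sin (?\<theta> x)" and ?dv = "\<lambda>x. s * (?r x * cos (?\<theta> x))"
  have v: "is_solution s ?v ?dv" by (rule polar_is_solution[OF s])
  have cos_cos: "cos ?\<alpha> * cos ?\<alpha> = 1"
    by simp
  have v0: "?v 0 = 0" "?dv 0 = s * cos ?\<alpha>"
    by (simp_all add: angle_0[OF s] radius_0 sin_npi)
  show ?thesis
  proof
    assume ?A
    have "?v L = 0" unfolding \<open>?A\<close> by (simp only: sin_npi mult_zero_right)
    then have "fucik_solution L m n t (s\<^sup>2) ?v ?dv"
      using v v0 by (simp add: fucik_solution_iff)
    moreover have card: "card (nodal_domains L ?v) = k"
      by (rule card_nodal_domains_polar[OF s \<open>?A\<close>, where a = 1]) auto
    moreover have "\<exists>x\<in>{0..L}. ?v x \<noteq> 0"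
    proof -
      have "nodal_domains L ?v \<noteq> {}" using card k by auto
      then have "{x \<in> {0<..<L}. ?v x \<noteq> 0} \<noteq> {}"
        unfolding nodal_domains_def by auto
      then show ?thesis by force
    qed
    moreover have "0 < cos ?\<alpha> * ?dv 0"
      unfolding v0(2) using s cos_cos by (metis mult.left_commute mult.right_neutral)
    ultimately show ?E by blast
  next
    assume ?E
    then obtain u du where u: "is_solution s u du" "u 0 = 0" "u L = 0"
      and card: "card (nodal_domains L u) = k" and du: "0 < cos ?\<alpha> * du 0"
      unfolding fucik_solution_iff by blast
    \<comment> \<open>The factor that matches the initial slopes, because \<open>(cos (j \<pi>))\<^sup>2 = 1\<close>.\<close>
    define a where "a = cos ?\<alpha> * du 0 / s"
    have a: "0 < a" using du s by (simp add: a_def)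
    have "u x = a * ?v x" if "x \<in> {0..L}" for x
    proof (rule solution_unique[OF u(1) is_solution_scale[OF v less_imp_le[OF a]] _ _ that])
      show "u 0 = a * ?v 0" using u(2) v0(1) by simp
      have "a * ?dv 0 = (cos ?\<alpha> * cos ?\<alpha>) * du 0"
        unfolding v0(2) a_def using s by simp
      then show "du 0 = a * ?dv 0" unfolding cos_cos by simp
    qed
    note uv = this
    have "sin (?\<theta> L) = 0"
      using uv[of L] u(3) a radius_pos[of ?\<alpha> s L] L_pos by simp
    then obtain q :: int where q: "?\<theta> L = of_int q * pi" by (auto simp: sin_zero_iff_int2)
    have "?\<alpha> < ?\<theta> L" using angle_less[OF s, of 0 L ?\<alpha>] L_pos by (simp add: angle_0[OF s])
    then have "real j < of_int q" unfolding q by (simp add: mult_less_cancel_right)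
    then have "int j < q" using of_int_less_iff[of "int j" q, where 'a = real] by simp
    define k' where "k' = nat (q - int j)"
    have "q = int (j + k')" using \<open>int j < q\<close> by (simp add: k'_def)
    then have fin: "?\<theta> L = real (j + k') * pi" using q by simp
    have "card (nodal_domains L u) = k'"
      using a by (intro card_nodal_domains_polar[OF s fin uv]) auto
    with fin card show ?A by simp
  qed
qed

lemma angle_end_le_iff:
  assumes "0 < s1" "0 < s2"
  shows "angle \<alpha> s1 L \<le> angle \<alpha> s2 L \<longleftrightarrow> s1 \<le> s2"
  using angle_end_strict_mono[OF assms(1), of s2 \<alpha>] angle_end_strict_mono[OF assms(2), of s1 \<alpha>]
  by (cases s1 s2 rule: linorder_cases) auto

definition eigenvalue :: "nat \<Rightarrow> nat \<Rightarrow> real" where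
  "eigenvalue j k = (THE \<mu>. 0 < \<mu> \<and>
     (\<exists>u du. fucik_solution L m n t \<mu> u du \<and> (\<exists>x\<in>{0..L}. u x \<noteq> 0) \<and>
        card (nodal_domains L u) = k \<and> 0 < cos (real j * pi) * du 0))"

lemma eigenvalue_le_iff:
  assumes k: "1 \<le> k" and \<mu>: "0 < \<mu>"
  shows "eigenvalue j k \<le> \<mu> \<longleftrightarrow> real (j + k) * pi \<le> angle (real j * pi) (sqrt \<mu>) L"
proof -
  let ?\<alpha> = "real j * pi"
  have "?\<alpha> < real (j + k) * pi" using k by simp
  then obtain s where s: "0 < s" "angle ?\<alpha> s L = real (j + k) * pi"
    using angle_end_attains by blast
  have "eigenvalue j k = s\<^sup>2"
    unfolding eigenvalue_def
  proof (rule the_equality)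
    show "0 < s\<^sup>2 \<and> (\<exists>u du. fucik_solution L m n t (s\<^sup>2) u du \<and> (\<exists>x\<in>{0..L}. u x \<noteq> 0) \<and>
        card (nodal_domains L u) = k \<and> 0 < cos (real j * pi) * du 0)"
      using eigenfunction_iff[OF s(1) k, of j] s by simp
  next
    fix \<mu>' assume *: "0 < \<mu>' \<and> (\<exists>u du. fucik_solution L m n t \<mu>' u du \<and> (\<exists>x\<in>{0..L}. u x \<noteq> 0) \<and>
        card (nodal_domains L u) = k \<and> 0 < cos (real j * pi) * du 0)"
    then have pos: "0 < sqrt \<mu>'" "\<mu>' = (sqrt \<mu>')\<^sup>2" by simp_all
    then have "angle ?\<alpha> (sqrt \<mu>') L = real (j + k) * pi"
      using eigenfunction_iff[OF pos(1) k, of j] * by simp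
    then have "sqrt \<mu>' = s"
      using angle_end_le_iff[OF pos(1) s(1), of ?\<alpha>] angle_end_le_iff[OF s(1) pos(1), of ?\<alpha>] s(2)
      by simp
    then show "\<mu>' = s\<^sup>2" using pos(2) by simp
  qed
  moreover have "s\<^sup>2 \<le> \<mu> \<longleftrightarrow> s \<le> sqrt \<mu>"
    using s(1) \<mu> by (metis less_imp_le real_le_rsqrt real_sqrt_ge_0_iff real_sqrt_pow2 power_mono)
  ultimately show ?thesis
    using angle_end_le_iff[of s "sqrt \<mu>" ?\<alpha>] s \<mu> by simp
qed

lemma card_eigenvalues_le:
  assumes \<mu>: "0 < \<mu>"
  shows "card {k. 1 \<le> k \<and> eigenvalue j k \<le> \<mu>}
    = nat \<lfloor>(angle (real j * pi) (sqrt \<mu>) L - real j * pi) / pi\<rfloor>"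
proof -
  let ?T = "(angle (real j * pi) (sqrt \<mu>) L - real j * pi) / pi"
  have "1 \<le> k \<and> eigenvalue j k \<le> \<mu> \<longleftrightarrow> k \<in> {1..nat \<lfloor>?T\<rfloor>}" for k
  proof (cases "1 \<le> k")
    case True
    have "eigenvalue j k \<le> \<mu> \<longleftrightarrow> real k * pi \<le> angle (real j * pi) (sqrt \<mu>) L - real j * pi"
      unfolding eigenvalue_le_iff[OF True \<mu>] by (simp add: distrib_right le_diff_eq add.commute)
    also have "\<dots> \<longleftrightarrow> real k \<le> ?T" by (simp add: pos_le_divide_eq)
    also have "\<dots> \<longleftrightarrow> int k \<le> \<lfloor>?T\<rfloor>" by (simp add: le_floor_iff)
    also have "\<dots> \<longleftrightarrow> k \<le> nat \<lfloor>?T\<rfloor>" using True by linarith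
    finally show ?thesis using True by simp
  qed simp
  then have "{k. 1 \<le> k \<and> eigenvalue j k \<le> \<mu>} = {1..nat \<lfloor>?T\<rfloor>}" by blast
  then show ?thesis by simp
qed

lemma counting_fun_eq:
  assumes \<mu>: "0 < \<mu>"
  shows "counting_fun L m n t \<mu> = nat \<lfloor>angle 0 (sqrt \<mu>) L / pi\<rfloor> + nat \<lfloor>(angle pi (sqrt \<mu>) L - pi) / pi\<rfloor>"
proof -
  have "eigval_plus L m n t = eigenvalue 0" "eigval_minus L m n t = eigenvalue 1"
    by (auto simp: fun_eq_iff eigval_plus_def eigval_minus_def eigenvalue_def)
  then show ?thesis
    using card_eigenvalues_le[OF \<mu>, of 0] card_eigenvalues_le[OF \<mu>, of 1]
    by (simp add: counting_fun_def)
qed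

end

section \<open>Averaging of the phase equation\<close>

text \<open>
  Up to the factor \<open>1 / \<alpha>\<close>, this is the angle \<open>arctan (\<alpha> tan \<theta>)\<close>, which turns uniformly when
  \<open>\<theta>' = cos\<^sup>2 \<theta> + \<alpha>\<^sup>2 sin\<^sup>2 \<theta>\<close>. Expressing its deviation from \<open>\<theta>\<close> by the addition theorem for
  \<open>arctan\<close> gives a formula that is smooth on the whole line, without the jumps of \<open>tan\<close>.
\<close>

lemma frozen_phase_has_derivative:
  fixes \<alpha> \<theta> :: real
  assumes \<alpha>: "0 < \<alpha>"
  shows "((\<lambda>\<theta>. (\<theta> + arctan ((\<alpha> - 1) * (sin \<theta> * cos \<theta>) / ((cos \<theta>)\<^sup>2 + \<alpha> * (sin \<theta>)\<^sup>2))) / \<alpha>)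
    has_real_derivative 1 / ((cos \<theta>)\<^sup>2 + \<alpha>\<^sup>2 * (sin \<theta>)\<^sup>2)) (at \<theta>)"
proof -
  define N where "N \<theta> = (\<alpha> - 1) * (sin \<theta> * cos \<theta>)" for \<theta>
  define D where "D \<theta> = (cos \<theta>)\<^sup>2 + \<alpha> * (sin \<theta>)\<^sup>2" for \<theta>
  define N' where "N' = (\<alpha> - 1) * ((cos \<theta>)\<^sup>2 - (sin \<theta>)\<^sup>2)"
  define D' where "D' = 2 * (\<alpha> - 1) * (sin \<theta> * cos \<theta>)"
  define Q where "Q = (cos \<theta>)\<^sup>2 + \<alpha>\<^sup>2 * (sin \<theta>)\<^sup>2"
  have sum_pos: "0 < (cos \<theta>)\<^sup>2 + b * (sin \<theta>)\<^sup>2" if "0 < b" for b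
  proof -
    have "0 < min 1 b * ((cos \<theta>)\<^sup>2 + (sin \<theta>)\<^sup>2)" using that by simp
    also have "\<dots> \<le> 1 * (cos \<theta>)\<^sup>2 + b * (sin \<theta>)\<^sup>2"
      unfolding distrib_left by (intro add_mono mult_right_mono) auto
    finally show ?thesis by simp
  qed
  have D: "0 < D \<theta>" and Q: "0 < Q"
    using \<alpha> by (auto simp: D_def Q_def intro!: sum_pos)
  have dN: "(N has_real_derivative N') (at \<theta>)"
    unfolding N_def N'_def by (auto intro!: derivative_eq_intros simp: power2_eq_square algebra_simps)
  have dD: "(D has_real_derivative D') (at \<theta>)"
    unfolding D_def D'_def by (auto intro!: derivative_eq_intros simp: power2_eq_square algebra_simps)
  have sc: "(sin \<theta>)\<^sup>2 + (cos \<theta>)\<^sup>2 = 1" by simp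
  have ND: "N' * D \<theta> - N \<theta> * D' = (\<alpha> - 1) * ((cos \<theta>)\<^sup>2 - \<alpha> * (sin \<theta>)\<^sup>2)"
    unfolding N_def D_def N'_def D'_def using sc by algebra
  have QND: "(D \<theta>)\<^sup>2 + (N \<theta>)\<^sup>2 = Q"
    unfolding N_def D_def Q_def using sc by algebra
  have QA: "Q + (\<alpha> - 1) * ((cos \<theta>)\<^sup>2 - \<alpha> * (sin \<theta>)\<^sup>2) = \<alpha>"
    unfolding Q_def using sc by algebra
  have "((\<lambda>\<theta>. arctan (N \<theta> / D \<theta>)) has_real_derivative
      inverse (1 + (N \<theta> / D \<theta>)\<^sup>2) * ((N' * D \<theta> - N \<theta> * D') / (D \<theta> * D \<theta>))) (at \<theta>)"
    using D by (intro DERIV_chain2[OF DERIV_arctan] DERIV_divide dN dD) auto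
  then have "((\<lambda>\<theta>. (\<theta> + arctan (N \<theta> / D \<theta>)) / \<alpha>) has_real_derivative
      (1 + inverse (1 + (N \<theta> / D \<theta>)\<^sup>2) * ((N' * D \<theta> - N \<theta> * D') / (D \<theta> * D \<theta>))) / \<alpha>) (at \<theta>)"
    by (intro DERIV_cdivide DERIV_add DERIV_ident)
  moreover have "inverse (1 + (N \<theta> / D \<theta>)\<^sup>2) * ((N' * D \<theta> - N \<theta> * D') / (D \<theta> * D \<theta>))
      = (N' * D \<theta> - N \<theta> * D') / ((D \<theta>)\<^sup>2 + (N \<theta>)\<^sup>2)"
  proof -
    have "1 + (N \<theta> / D \<theta>)\<^sup>2 = ((D \<theta>)\<^sup>2 + (N \<theta>)\<^sup>2) / (D \<theta> * D \<theta>)"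
      using D by (simp add: field_simps power2_eq_square)
    then show ?thesis using D by simp
  qed
  moreover have "(1 + (N' * D \<theta> - N \<theta> * D') / ((D \<theta>)\<^sup>2 + (N \<theta>)\<^sup>2)) / \<alpha> = 1 / Q"
  proof -
    have "1 + (N' * D \<theta> - N \<theta> * D') / ((D \<theta>)\<^sup>2 + (N \<theta>)\<^sup>2) = \<alpha> / Q"
      unfolding ND QND using Q QA by (simp add: field_simps)
    then show ?thesis using \<alpha> by simp
  qed
  ultimately show ?thesis by (simp add: N_def D_def Q_def)
qed

lemma half_period_has_integral:
  fixes \<alpha> :: real and i :: nat
  assumes \<alpha>: "0 < \<alpha>"
    and eq: "\<And>\<theta>. real i * pi \<le> \<theta> \<Longrightarrow> \<theta> \<le> real (Suc i) * pi \<Longrightarrow>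
      f \<theta> = 1 / ((cos \<theta>)\<^sup>2 + \<alpha>\<^sup>2 * (sin \<theta>)\<^sup>2)"
  shows "(f has_integral pi / \<alpha>) {real i * pi..real (Suc i) * pi}"
proof -
  define \<Psi> where "\<Psi> \<theta> = (\<theta> + arctan ((\<alpha> - 1) * (sin \<theta> * cos \<theta>) / ((cos \<theta>)\<^sup>2 + \<alpha> * (sin \<theta>)\<^sup>2))) / \<alpha>" for \<theta>
  have "(f has_integral \<Psi> (real (Suc i) * pi) - \<Psi> (real i * pi)) {real i * pi..real (Suc i) * pi}"
  proof (rule fundamental_theorem_of_calculus)
    show "real i * pi \<le> real (Suc i) * pi" by (intro mult_right_mono) auto
    fix \<theta> assume "\<theta> \<in> {real i * pi..real (Suc i) * pi}"
    then have "(\<Psi> has_real_derivative f \<theta>) (at \<theta>)"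
      using frozen_phase_has_derivative[OF \<alpha>, of \<theta>] eq[of \<theta>] by (simp add: \<Psi>_def[abs_def])
    then show "(\<Psi> has_vector_derivative f \<theta>) (at \<theta> within {real i * pi..real (Suc i) * pi})"
      by (simp add: has_real_derivative_iff_has_vector_derivative has_vector_derivative_at_within)
  qed
  moreover have \<Psi>: "\<Psi> (real l * pi) = real l * pi / \<alpha>" for l
    unfolding \<Psi>_def by (simp only: sin_npi mult_zero_left mult_zero_right div_0 arctan_zero_zero add_0_right)
  have "\<Psi> (real (Suc i) * pi) - \<Psi> (real i * pi) = pi / \<alpha>"
    unfolding \<Psi> by (simp add: add_divide_distrib distrib_right)
  ultimately show ?thesis by simp
qed

context two_phase
begin

text \<open>
  The length \<open>2 \<pi>\<close> of a full turn divided by its duration \<open>\<pi> / \<surd>m + \<pi> / \<surd>(t n)\<close>.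
\<close>

definition mean_speed :: "real \<Rightarrow> real" where
  "mean_speed x = 2 / (1 / sqrt (m x) + 1 / sqrt (t * n x))"

text \<open>
  The time that the motion with \<open>s = 1\<close> and coefficients frozen at \<open>y\<close> takes to turn from \<open>0\<close> to \<open>\<theta>\<close>.
\<close>

definition phase_time :: "real \<Rightarrow> real \<Rightarrow> real" where
  "phase_time y \<theta> = integral {0..\<theta>} (\<lambda>\<phi>. 1 / speed y \<phi>)"

lemma sqrt_pos: "x \<in> {0..L} \<Longrightarrow> 0 < sqrt (m x)" "x \<in> {0..L} \<Longrightarrow> 0 < sqrt (t * n x)"
  using m_bounds[of x] n_bounds[of x] c_pos by auto

lemma mean_speed_pos: "x \<in> {0..L} \<Longrightarrow> 0 < mean_speed x"
  unfolding mean_speed_def using sqrt_pos by (intro divide_pos_pos add_pos_pos) auto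

lemma continuous_mean_speed: "continuous_on {0..L} mean_speed"
proof -
  have "1 / sqrt (m x) + 1 / sqrt (t * n x) \<noteq> 0" if "x \<in> {0..L}" for x
    using sqrt_pos[OF that] by (smt (verit) divide_pos_pos)
  moreover have "sqrt (m x) \<noteq> 0" "sqrt (t * n x) \<noteq> 0" if "x \<in> {0..L}" for x
    using sqrt_pos[OF that] by auto
  ultimately show ?thesis unfolding mean_speed_def
    by (intro continuous_on_divide continuous_on_add continuous_on_const
        continuous_on_real_sqrt continuous_on_mult cont_m cont_n) auto
qed

lemma continuous_inverse_speed:
  assumes "y \<in> {0..L}"
  shows "continuous_on S (\<lambda>\<phi>. 1 / speed y \<phi>)"
proof -
  have "speed y \<phi> \<noteq> 0" for \<phi> using speed_pos[OF assms, of \<phi>] by simp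
  then show ?thesis
    using assms by (intro continuous_on_divide continuous_on_const continuous_speed continuous_on_id) auto
qed

lemma integrable_inverse_speed: "y \<in> {0..L} \<Longrightarrow> (\<lambda>\<phi>. 1 / speed y \<phi>) integrable_on {a..b}"
  by (intro integrable_continuous_real continuous_inverse_speed)

lemma phase_time_mono:
  assumes "y \<in> {0..L}" "0 \<le> a" "a \<le> b"
  shows "phase_time y a \<le> phase_time y b"
  unfolding phase_time_def
  using assms speed_pos[OF assms(1)]
  by (intro integral_subset_le integrable_inverse_speed) (auto intro: less_imp_le)

text \<open>
  Each full turn consists of a half turn with \<open>sin \<theta> \<ge> 0\<close>, where only \<open>m y\<close> acts, and one with
  \<open>sin \<theta> \<le> 0\<close>, where only \<open>t * n y\<close> acts.
\<close>

lemma mean_speed_phase_time_period: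
  assumes y: "y \<in> {0..L}"
  shows "mean_speed y * phase_time y (real (2 * i) * pi) = real (2 * i) * pi"
proof -
  have "phase_time y (real (2 * i) * pi) = real i * (pi / sqrt (m y) + pi / sqrt (t * n y))"
  proof (induction i)
    case (Suc i)
    have pq: "0 < sqrt (m y)" "0 < sqrt (t * n y)" using sqrt_pos[OF y] by auto
    have sq: "(sqrt (m y))\<^sup>2 = m y" "(sqrt (t * n y))\<^sup>2 = t * n y" using pq by auto
    have s1: "0 \<le> sin \<theta>" if "real (2 * i) * pi \<le> \<theta>" "\<theta> \<le> real (Suc (2 * i)) * pi" for \<theta>
    proof -
      have "0 \<le> sin (\<theta> - real (2 * i) * pi)"
        using that by (intro sin_ge_zero) (auto simp: algebra_simps)
      then show ?thesis by (simp add: sin_diff)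
    qed
    have s2: "sin \<theta> \<le> 0" if "real (Suc (2 * i)) * pi \<le> \<theta>" "\<theta> \<le> real (Suc (Suc (2 * i))) * pi" for \<theta>
    proof -
      have "0 \<le> sin (\<theta> - real (Suc (2 * i)) * pi)"
        using that by (intro sin_ge_zero) (auto simp: algebra_simps)
      then show ?thesis unfolding sin_diff sin_npi cos_npi by simp
    qed
    have 1: "((\<lambda>\<phi>. 1 / speed y \<phi>) has_integral pi / sqrt (m y)) {real (2 * i) * pi..real (Suc (2 * i)) * pi}"
      by (rule half_period_has_integral[OF pq(1)], unfold sq, drule (1) s1)
        (simp add: speed_def force_def pos_part_def neg_part_def power2_eq_square)
    have 2: "((\<lambda>\<phi>. 1 / speed y \<phi>) has_integral pi / sqrt (t * n y))
        {real (Suc (2 * i)) * pi..real (Suc (Suc (2 * i))) * pi}"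
      by (rule half_period_has_integral[OF pq(2)], unfold sq, drule (1) s2)
        (simp add: speed_def force_def pos_part_def neg_part_def power2_eq_square)
    have "phase_time y (real (2 * Suc i) * pi) = phase_time y (real (2 * i) * pi)
        + (integral {real (2 * i) * pi..real (Suc (2 * i)) * pi} (\<lambda>\<phi>. 1 / speed y \<phi>)
        + integral {real (Suc (2 * i)) * pi..real (Suc (Suc (2 * i))) * pi} (\<lambda>\<phi>. 1 / speed y \<phi>))"
    proof -
      have "integral {real (2 * i) * pi..real (Suc (2 * i)) * pi} (\<lambda>\<phi>. 1 / speed y \<phi>)
        + integral {real (Suc (2 * i)) * pi..real (Suc (Suc (2 * i))) * pi} (\<lambda>\<phi>. 1 / speed y \<phi>)
        = integral {real (2 * i) * pi..real (Suc (Suc (2 * i))) * pi} (\<lambda>\<phi>. 1 / speed y \<phi>)"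
        by (intro Henstock_Kurzweil_Integration.integral_combine integrable_inverse_speed y mult_right_mono) auto
      moreover have "phase_time y (real (2 * i) * pi)
          + integral {real (2 * i) * pi..real (Suc (Suc (2 * i))) * pi} (\<lambda>\<phi>. 1 / speed y \<phi>)
          = phase_time y (real (Suc (Suc (2 * i))) * pi)"
        unfolding phase_time_def
        by (intro Henstock_Kurzweil_Integration.integral_combine integrable_inverse_speed y mult_right_mono) auto
      moreover have "2 * Suc i = Suc (Suc (2 * i))" by simp
      ultimately show ?thesis by (simp only:)
    qed
    then show ?case
      unfolding Suc.IH integral_unique[OF 1] integral_unique[OF 2]
      by (simp add: add_divide_distrib algebra_simps)
  qed (simp add: phase_time_def)
  moreover have "0 < 1 / sqrt (m y) + 1 / sqrt (t * n y)"
    using sqrt_pos[OF y] by (intro add_pos_pos) auto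
  then have "1 / sqrt (m y) + 1 / sqrt (t * n y) \<noteq> 0" by simp
  then have "mean_speed y * (1 / sqrt (m y) + 1 / sqrt (t * n y)) = 2"
    unfolding mean_speed_def times_divide_eq_left by (rule nonzero_mult_div_cancel_right)
  then have "real i * pi * (mean_speed y * (1 / sqrt (m y) + 1 / sqrt (t * n y))) = real i * pi * 2"
    by simp
  then have "mean_speed y * (real i * (pi / sqrt (m y) + pi / sqrt (t * n y))) = real (2 * i) * pi"
    by (simp add: algebra_simps)
  ultimately show ?thesis by simp
qed

text \<open>
  Both functions of \<open>\<theta>\<close> increase and they agree at the multiples of \<open>2 \<pi>\<close>, so they cannot differ by
  more than one full turn.
\<close>

lemma mean_speed_phase_time_approx:
  assumes y: "y \<in> {0..L}" and \<theta>: "0 \<le> \<theta>"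
  shows "\<bar>mean_speed y * phase_time y \<theta> - \<theta>\<bar> \<le> 2 * pi"
proof -
  define i where "i = nat \<lfloor>\<theta> / (2 * pi)\<rfloor>"
  have "0 \<le> \<theta> / (2 * pi)" using \<theta> by simp
  then have "real i \<le> \<theta> / (2 * pi)" "\<theta> / (2 * pi) < real i + 1"
    unfolding i_def by linarith+
  then have i: "real (2 * i) * pi \<le> \<theta>" "\<theta> \<le> real (2 * Suc i) * pi"
    by (simp_all add: field_simps)
  have "mean_speed y * phase_time y (real (2 * i) * pi) \<le> mean_speed y * phase_time y \<theta>"
    using i y mean_speed_pos[OF y] by (intro mult_left_mono phase_time_mono) auto
  moreover have "mean_speed y * phase_time y \<theta> \<le> mean_speed y * phase_time y (real (2 * Suc i) * pi)"
    using i \<theta> y mean_speed_pos[OF y] by (intro mult_left_mono phase_time_mono) auto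
  ultimately have "real (2 * i) * pi \<le> mean_speed y * phase_time y \<theta>"
    "mean_speed y * phase_time y \<theta> \<le> real (2 * Suc i) * pi"
    unfolding mean_speed_phase_time_period[OF y] by simp_all
  moreover have "real (2 * Suc i) * pi = real (2 * i) * pi + 2 * pi" by (simp add: algebra_simps)
  ultimately show ?thesis using i by linarith
qed

lemma speed_diff_le: "\<bar>speed x \<theta> - speed y \<theta>\<bar> \<le> \<bar>m x - m y\<bar> + \<bar>t * n x - t * n y\<bar>"
proof -
  let ?p = "sin \<theta> * pos_part (sin \<theta>)" and ?n = "sin \<theta> * neg_part (sin \<theta>)"
  have "\<bar>?p\<bar> \<le> 1 * 1" "\<bar>?n\<bar> \<le> 1 * 1"
    unfolding abs_mult by (intro mult_mono; simp add: pos_part_def neg_part_def)+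
  then have *: "\<bar>(m x - m y) * ?p\<bar> \<le> \<bar>m x - m y\<bar>"
      "\<bar>(t * n x - t * n y) * ?n\<bar> \<le> \<bar>t * n x - t * n y\<bar>"
    unfolding abs_mult[of "m x - m y"] abs_mult[of "t * n x - t * n y"]
    by (intro mult_left_le; simp)+
  have eq: "speed x \<theta> - speed y \<theta> = (m x - m y) * ?p - (t * n x - t * n y) * ?n"
    by (simp add: speed_def force_def algebra_simps)
  show ?thesis
    unfolding eq by (rule order_trans[OF abs_triangle_ineq4 add_mono[OF *]])
qed

text \<open>
  Freezing the coefficients is harmless on short intervals: this combines uniform continuity of the
  coefficients and of the mean speed with the lower bound on the speed. Uniformity in \<open>\<theta>\<close> is
  essential, because \<open>\<theta>\<close> makes many turns on each short interval.
\<close>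

lemma frozen_speed_uniformly_close:
  assumes "0 < \<epsilon>"
  shows "\<exists>\<delta>>0. \<forall>x\<in>{0..L}. \<forall>y\<in>{0..L}. \<bar>x - y\<bar> < \<delta> \<longrightarrow>
    (\<forall>\<theta>. \<bar>mean_speed y * (speed x \<theta> / speed y \<theta>) - mean_speed x\<bar> \<le> \<epsilon>)"
proof -
  have "compact (mean_speed ` {0..L})"
    by (intro compact_continuous_image continuous_mean_speed) auto
  then obtain B where B: "0 < B" "\<And>x. x \<in> {0..L} \<Longrightarrow> \<bar>mean_speed x\<bar> \<le> B"
    using compact_imp_bounded bounded_pos by (metis (no_types, lifting) imageI real_norm_def)
  \<comment> \<open>With this tolerance for each coefficient, the change of speed costs at most \<open>B * (2 * \<eta>) / min 1 c = \<epsilon> / 2\<close>.\<close>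
  define \<eta> where "\<eta> = \<epsilon> * min 1 c / (4 * B)"
  have \<eta>: "0 < \<eta>" using assms c_pos B by (simp add: \<eta>_def)
  have unif: "\<exists>\<delta>>0. \<forall>x\<in>{0..L}. \<forall>y\<in>{0..L}. \<bar>x - y\<bar> < \<delta> \<longrightarrow> \<bar>f x - f y\<bar> < e"
    if "continuous_on {0..L} f" "0 < e" for f :: "real \<Rightarrow> real" and e
    using compact_uniformly_continuous[OF that(1)] that(2)
    unfolding uniformly_continuous_on_def dist_real_def by (metis abs_minus_commute compact_Icc)
  obtain \<delta>1 where \<delta>1: "0 < \<delta>1"
    "\<And>x y. x \<in> {0..L} \<Longrightarrow> y \<in> {0..L} \<Longrightarrow> \<bar>x - y\<bar> < \<delta>1 \<Longrightarrow> \<bar>m x - m y\<bar> < \<eta>"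
    using unif[OF cont_m \<eta>] by blast
  obtain \<delta>2 where \<delta>2: "0 < \<delta>2"
    "\<And>x y. x \<in> {0..L} \<Longrightarrow> y \<in> {0..L} \<Longrightarrow> \<bar>x - y\<bar> < \<delta>2 \<Longrightarrow> \<bar>t * n x - t * n y\<bar> < \<eta>"
    using unif[OF continuous_on_mult[OF continuous_on_const cont_n] \<eta>, of t] by blast
  obtain \<delta>3 where \<delta>3: "0 < \<delta>3"
    "\<And>x y. x \<in> {0..L} \<Longrightarrow> y \<in> {0..L} \<Longrightarrow> \<bar>x - y\<bar> < \<delta>3 \<Longrightarrow>
      \<bar>mean_speed x - mean_speed y\<bar> < \<epsilon> / 2"
    using unif[OF continuous_mean_speed, of "\<epsilon> / 2"] assms by auto
  show ?thesis
  proof (intro exI[of _ "min \<delta>1 (min \<delta>2 \<delta>3)"] conjI ballI impI allI)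
    fix x y \<theta> assume x: "x \<in> {0..L}" and y: "y \<in> {0..L}" and xy: "\<bar>x - y\<bar> < min \<delta>1 (min \<delta>2 \<delta>3)"
    have sy: "0 < speed y \<theta>" by (rule speed_pos[OF y])
    have "\<bar>speed x \<theta> - speed y \<theta>\<bar> \<le> 2 * \<eta>"
      using speed_diff_le[of x \<theta> y] \<delta>1(2)[OF x y] \<delta>2(2)[OF x y] xy by linarith
    then have "\<bar>mean_speed y\<bar> * \<bar>speed x \<theta> - speed y \<theta>\<bar> \<le> B * (2 * \<eta>)"
      using B(1) B(2)[OF y] by (intro mult_mono) auto
    also have "\<dots> = \<epsilon> / 2 * min 1 c"
      using B(1) by (simp add: \<eta>_def)
    also have "\<dots> \<le> \<epsilon> / 2 * speed y \<theta>"
      using assms speed_lower[OF y] by (intro mult_left_mono) auto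
    finally have "\<bar>mean_speed y\<bar> * \<bar>speed x \<theta> - speed y \<theta>\<bar> / speed y \<theta> \<le> \<epsilon> / 2"
      using sy by (simp add: pos_divide_le_eq)
    moreover have "\<bar>mean_speed y * ((speed x \<theta> - speed y \<theta>) / speed y \<theta>)\<bar>
        = \<bar>mean_speed y\<bar> * \<bar>speed x \<theta> - speed y \<theta>\<bar> / speed y \<theta>"
      using sy by (simp add: abs_mult)
    moreover have "mean_speed y * (speed x \<theta> / speed y \<theta>) - mean_speed x
        = mean_speed y * ((speed x \<theta> - speed y \<theta>) / speed y \<theta>) - (mean_speed x - mean_speed y)"
      using sy by (simp add: field_simps)
    moreover have "\<bar>mean_speed x - mean_speed y\<bar> < \<epsilon> / 2"
      using \<delta>3(2)[OF x y] xy by simp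
    ultimately show "\<bar>mean_speed y * (speed x \<theta> / speed y \<theta>) - mean_speed x\<bar> \<le> \<epsilon>"
      by linarith
  qed (use \<delta>1 \<delta>2 \<delta>3 in auto)
qed

lemma phase_time_has_derivative:
  assumes "y \<in> {0..L}" "0 < \<theta>"
  shows "(phase_time y has_real_derivative 1 / speed y \<theta>) (at \<theta>)"
proof -
  have "(phase_time y has_real_derivative 1 / speed y \<theta>) (at \<theta> within {0..\<theta> + 1})"
    unfolding phase_time_def[abs_def] using assms
    by (intro integral_has_real_derivative continuous_inverse_speed) auto
  then show ?thesis using at_within_Icc_at[of 0 \<theta> "\<theta> + 1"] assms by simp
qed

text \<open>
  Here \<open>D x\<close> is the angle in the uniformly turning variable minus its expected value. Its derivative is
  at most \<open>\<epsilon> s\<close> in absolute value by \<open>close\<close>, and returning to the true angle costs \<open>2 \<pi>\<close> at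
  each end. The bound \<open>4 \<pi>\<close> does not depend on \<open>s\<close>, which is what makes it negligible.
\<close>

lemma angle_increment_on_short_interval:
  assumes s: "0 < s" and \<alpha>: "0 \<le> \<alpha>" and ab: "0 \<le> a" "a \<le> b" "b \<le> L"
    and close: "\<And>x \<theta>. x \<in> {a..b} \<Longrightarrow> \<bar>mean_speed a * (speed x \<theta> / speed a \<theta>) - mean_speed x\<bar> \<le> \<epsilon>"
  shows "\<bar>(angle \<alpha> s b - angle \<alpha> s a) - s * integral {a..b} mean_speed\<bar> \<le> 4 * pi + \<epsilon> * s * (b - a)"
proof -
  have a: "a \<in> {0..L}" using ab by simp
  let ?\<theta> = "angle \<alpha> s"
  have \<theta>_nonneg: "0 \<le> ?\<theta> x" if "x \<in> {0..L}" for x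
  proof -
    have "0 \<le> s * min 1 c * (x - 0)" using s c_pos that by simp
    then show ?thesis using angle_growth(1)[OF s, of 0 x \<alpha>] that \<alpha> by (simp add: angle_0[OF s])
  qed
  have \<theta>_pos: "0 < ?\<theta> x" if "x \<in> {a<..<b}" for x
    using angle_less[OF s, of a x \<alpha>] \<theta>_nonneg[OF a] that ab by auto
  define D where "D x = mean_speed a * phase_time a (?\<theta> x) - s * integral {0..x} mean_speed" for x
  have contD: "continuous_on {a..b} D"
  proof -
    have cont\<theta>: "continuous_on {a..b} ?\<theta>"
      using ab by (intro continuous_on_subset[OF continuous_angle[OF s]]) auto
    have "continuous_on {0..?\<theta> b} (phase_time a)"
      unfolding phase_time_def[abs_def]
      by (intro indefinite_integral_continuous_1 integrable_inverse_speed a)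
    moreover have "?\<theta> x \<in> {0..?\<theta> b}" if "x \<in> {a..b}" for x
      using that ab \<theta>_nonneg[of x] angle_less[OF s, of x b \<alpha>] by (cases "x = b") auto
    then have "?\<theta> ` {a..b} \<subseteq> {0..?\<theta> b}" by blast
    ultimately have "continuous_on {a..b} (\<lambda>x. phase_time a (?\<theta> x))"
      using cont\<theta> by (metis continuous_on_compose2)
    moreover have "continuous_on {a..b} (\<lambda>x. integral {0..x} mean_speed)"
      by (rule continuous_on_subset[OF indefinite_integral_continuous_1[of _ 0 L]])
        (use ab in \<open>auto intro: integrable_continuous_real continuous_mean_speed\<close>)
    ultimately show ?thesis unfolding D_def
      by (intro continuous_on_diff continuous_on_mult continuous_on_const)
  qed
  have derD: "\<exists>d. (D has_real_derivative d) (at x) \<and> \<bar>d\<bar> \<le> \<epsilon> * s" if x: "x \<in> {a<..<b}" for x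
  proof -
    have xL: "x \<in> {0<..<L}" using x ab by auto
    then have xL': "x \<in> {0..L}" by simp
    have "((\<lambda>x. integral {0..x} mean_speed) has_real_derivative mean_speed x) (at x)"
      using integral_has_real_derivative[OF continuous_mean_speed xL'] at_within_Icc_at[of 0 x L] xL
      by simp
    then have "(D has_real_derivative mean_speed a * (1 / speed a (?\<theta> x) * (s * speed x (?\<theta> x)))
        - s * mean_speed x) (at x)"
      unfolding D_def[abs_def]
      by (intro DERIV_diff DERIV_cmult DERIV_chain2[OF phase_time_has_derivative]
          angle_has_derivative a \<theta>_pos x xL s)
    moreover have "mean_speed a * (1 / speed a (?\<theta> x) * (s * speed x (?\<theta> x))) - s * mean_speed x
        = (mean_speed a * (speed x (?\<theta> x) / speed a (?\<theta> x)) - mean_speed x) * s"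
      by (simp add: algebra_simps)
    moreover have "\<bar>(mean_speed a * (speed x (?\<theta> x) / speed a (?\<theta> x)) - mean_speed x) * s\<bar> \<le> \<epsilon> * s"
      unfolding abs_mult abs_of_pos[OF s] using s x by (intro mult_right_mono close) auto
    ultimately show ?thesis by auto
  qed
  have "D a - \<epsilon> * s * a \<ge> D b - \<epsilon> * s * b"
  proof (rule DERIV_nonpos_imp_decreasing_open[where f = "\<lambda>x. D x - \<epsilon> * s * x" and a = a and b = b])
    fix x assume "a < x" "x < b"
    then obtain d where d: "(D has_real_derivative d) (at x)" "\<bar>d\<bar> \<le> \<epsilon> * s" using derD[of x] by auto
    have "((\<lambda>x. D x - \<epsilon> * s * x) has_real_derivative d - \<epsilon> * s * 1) (at x)"
      by (intro DERIV_diff d DERIV_cmult DERIV_ident)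
    then show "\<exists>y. ((\<lambda>x. D x - \<epsilon> * s * x) has_real_derivative y) (at x) \<and> y \<le> 0"
      using d(2) by (intro exI[of _ "d - \<epsilon> * s * 1"]) auto
  qed (use ab contD in \<open>auto intro!: continuous_on_diff continuous_on_mult continuous_on_const continuous_on_id\<close>)
  moreover have "D a + \<epsilon> * s * a \<le> D b + \<epsilon> * s * b"
  proof (rule DERIV_nonneg_imp_increasing_open[where f = "\<lambda>x. D x + \<epsilon> * s * x" and a = a and b = b])
    fix x assume "a < x" "x < b"
    then obtain d where d: "(D has_real_derivative d) (at x)" "\<bar>d\<bar> \<le> \<epsilon> * s" using derD[of x] by auto
    have "((\<lambda>x. D x + \<epsilon> * s * x) has_real_derivative d + \<epsilon> * s * 1) (at x)"
      by (intro DERIV_add d DERIV_cmult DERIV_ident)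
    then show "\<exists>y. ((\<lambda>x. D x + \<epsilon> * s * x) has_real_derivative y) (at x) \<and> 0 \<le> y"
      using d(2) by (intro exI[of _ "d + \<epsilon> * s * 1"]) auto
  qed (use ab contD in \<open>auto intro!: continuous_on_add continuous_on_mult continuous_on_const continuous_on_id\<close>)
  ultimately have "\<bar>D b - D a\<bar> \<le> \<epsilon> * s * (b - a)"
    by (simp add: right_diff_distrib abs_le_iff)
  moreover have "D b - D a = (mean_speed a * phase_time a (?\<theta> b) - mean_speed a * phase_time a (?\<theta> a))
      - s * integral {a..b} mean_speed"
  proof -
    have "integral {0..a} mean_speed + integral {a..b} mean_speed = integral {0..b} mean_speed"
      using ab by (intro Henstock_Kurzweil_Integration.integral_combine integrable_continuous_real
          continuous_on_subset[OF continuous_mean_speed]) auto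
    then have "s * integral {0..b} mean_speed
        = s * integral {0..a} mean_speed + s * integral {a..b} mean_speed"
      by (simp flip: distrib_left)
    then show ?thesis unfolding D_def by linarith
  qed
  moreover have "\<bar>mean_speed a * phase_time a (?\<theta> x) - ?\<theta> x\<bar> \<le> 2 * pi" if "x \<in> {0..L}" for x
    by (rule mean_speed_phase_time_approx[OF a \<theta>_nonneg[OF that]])
  from this[of a] this[of b] have
    "\<bar>mean_speed a * phase_time a (?\<theta> a) - ?\<theta> a\<bar> \<le> 2 * pi"
    "\<bar>mean_speed a * phase_time a (?\<theta> b) - ?\<theta> b\<bar> \<le> 2 * pi" using ab by auto
  ultimately show ?thesis by linarith
qed

text \<open>
  The interval is cut into \<open>N\<close> pieces, with \<open>N\<close> depending on the tolerance but not on \<open>s\<close>. The total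
  error \<open>4 \<pi> N + \<epsilon> s L\<close> is then below \<open>e s\<close> for all large \<open>s\<close>.
\<close>

lemma angle_increment_asymptotics:
  assumes \<alpha>: "0 \<le> \<alpha>"
  shows "((\<lambda>s. (angle \<alpha> s L - \<alpha>) / s) \<longlongrightarrow> integral {0..L} mean_speed) at_top"
proof (rule tendstoI)
  fix e :: real assume e: "0 < e"
  define \<epsilon> where "\<epsilon> = e / (2 * L)"
  have \<epsilon>: "0 < \<epsilon>" "\<epsilon> * L = e / 2" using e L_pos by (simp_all add: \<epsilon>_def)
  obtain \<delta> where \<delta>: "0 < \<delta>" "\<And>x y \<theta>. x \<in> {0..L} \<Longrightarrow> y \<in> {0..L} \<Longrightarrow> \<bar>x - y\<bar> < \<delta> \<Longrightarrow>
      \<bar>mean_speed y * (speed x \<theta> / speed y \<theta>) - mean_speed x\<bar> \<le> \<epsilon>"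
    using frozen_speed_uniformly_close[OF \<epsilon>(1)] by blast
  obtain N :: nat where N: "L / \<delta> < real N" using reals_Archimedean2 by blast
  have "0 < L / \<delta>" using L_pos \<delta>(1) by simp
  then have N0: "0 < real N" using N by linarith
  define h where "h = L / real N"
  have h: "0 < h" "h < \<delta>" "real N * h = L"
    using N N0 L_pos \<delta>(1) by (auto simp: h_def field_simps)
  have step: "\<bar>angle \<alpha> s (real i * h) - \<alpha> - s * integral {0..real i * h} mean_speed\<bar>
      \<le> real i * (4 * pi) + \<epsilon> * s * (real i * h)" if s: "0 < s" and "i \<le> N" for s i
    using \<open>i \<le> N\<close>
  proof (induction i)
    case 0
    then show ?case by (simp add: angle_0[OF s])
  next
    case (Suc i)
    let ?a = "real i * h" and ?b = "real (Suc i) * h"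
    have "?b \<le> real N * h" using Suc.prems h(1) by (intro mult_right_mono) auto
    then have ab: "0 \<le> ?a" "?a \<le> ?b" "?b \<le> L" using h by (auto intro!: mult_right_mono)
    have ba: "?b - ?a = h" by (simp add: algebra_simps)
    have "\<bar>(angle \<alpha> s ?b - angle \<alpha> s ?a) - s * integral {?a..?b} mean_speed\<bar>
        \<le> 4 * pi + \<epsilon> * s * (?b - ?a)"
    proof (rule angle_increment_on_short_interval[OF s \<alpha> ab])
      fix x \<theta> assume "x \<in> {?a..?b}"
      then have x: "?a \<le> x" "x \<le> ?b" by (simp_all only: atLeastAtMost_iff)
      show "\<bar>mean_speed ?a * (speed x \<theta> / speed ?a \<theta>) - mean_speed x\<bar> \<le> \<epsilon>"
      proof (rule \<delta>(2))
        show "x \<in> {0..L}" "?a \<in> {0..L}"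
          unfolding atLeastAtMost_iff using x ab by linarith+
        show "\<bar>x - ?a\<bar> < \<delta>" using x ba h(2) by linarith
      qed
    qed
    moreover have "\<bar>angle \<alpha> s ?a - \<alpha> - s * integral {0..?a} mean_speed\<bar>
        \<le> real i * (4 * pi) + \<epsilon> * s * ?a"
      using Suc by simp
    moreover have "integral {0..?a} mean_speed + integral {?a..?b} mean_speed = integral {0..?b} mean_speed"
      using ab by (intro Henstock_Kurzweil_Integration.integral_combine integrable_continuous_real
          continuous_on_subset[OF continuous_mean_speed]) auto
    then have "s * integral {0..?b} mean_speed
        = s * integral {0..?a} mean_speed + s * integral {?a..?b} mean_speed"
      by (simp flip: distrib_left)
    moreover have "real (Suc i) * (4 * pi) = real i * (4 * pi) + 4 * pi" by (simp add: distrib_right)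
    moreover have "\<epsilon> * s * ?b = \<epsilon> * s * ?a + \<epsilon> * s * (?b - ?a)" by (simp add: right_diff_distrib)
    ultimately show ?case by linarith
  qed
  have "eventually (\<lambda>s. max 0 (real N * (8 * pi) / e) < s) at_top" by (rule eventually_gt_at_top)
  then show "\<forall>\<^sub>F s in at_top. dist ((angle \<alpha> s L - \<alpha>) / s) (integral {0..L} mean_speed) < e"
  proof eventually_elim
    case (elim s)
    then have s: "0 < s" and "real N * (8 * pi) / e < s" by simp_all
    then have "real N * (4 * pi) < e / 2 * s" using e by (simp add: field_simps)
    moreover have "\<epsilon> * s * L = e / 2 * s" using \<epsilon>(2) by (simp add: mult.commute mult.left_commute)
    ultimately have "\<bar>angle \<alpha> s L - \<alpha> - s * integral {0..L} mean_speed\<bar> < e * s"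
      using step[OF s order_refl] unfolding h(3) by linarith
    moreover have "dist ((angle \<alpha> s L - \<alpha>) / s) (integral {0..L} mean_speed)
        = \<bar>angle \<alpha> s L - \<alpha> - s * integral {0..L} mean_speed\<bar> / s"
    proof -
      have "(angle \<alpha> s L - \<alpha>) / s - integral {0..L} mean_speed
          = (angle \<alpha> s L - \<alpha> - s * integral {0..L} mean_speed) / s"
        using s by (simp add: field_simps)
      then show ?thesis using s by (simp add: dist_real_def)
    qed
    ultimately show ?case using s by (simp add: pos_divide_less_eq)
  qed
qed

end

section \<open>The Weyl asymptotics\<close>

lemma abs_nat_floor_diff_le: "0 \<le> x \<Longrightarrow> \<bar>real (nat \<lfloor>x\<rfloor>) - x\<bar> \<le> 1"
  by linarith

theorem theorem1p6:
  fixes L t :: real and m n :: "real \<Rightarrow> real"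
  assumes "L > 0"
    and "continuous_on {0..L} m" and "continuous_on {0..L} n"
    and "\<exists>c>0. \<forall>x\<in>{0..L}. c \<le> m x"
    and "\<exists>c>0. \<forall>x\<in>{0..L}. c \<le> n x"
    and "t > 0"
  shows "(\<lambda>\<mu>. real (counting_fun L m n t \<mu>)
            - 4 * sqrt \<mu> / pi *
              integral {0..L} (\<lambda>x. inverse (m x powr (-1/2) + (n x * t) powr (-1/2))))
         \<in> o[at_top](\<lambda>\<mu>. sqrt \<mu>)"
proof -
  obtain c1 c2 where c1: "0 < c1" "\<And>x. x \<in> {0..L} \<Longrightarrow> c1 \<le> m x"
    and c2: "0 < c2" "\<And>x. x \<in> {0..L} \<Longrightarrow> c2 \<le> n x"
    using assms(4,5) by blast
  have bdd: "\<exists>B. \<forall>x\<in>{0..L}. f x \<le> B" if "continuous_on {0..L} f" for f :: "real \<Rightarrow> real"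
  proof -
    have "bounded (f ` {0..L})"
      by (intro compact_imp_bounded compact_continuous_image that compact_Icc)
    then show ?thesis using bounded_imp_bdd_above by (fastforce simp: bdd_above_def)
  qed
  obtain B1 where B1: "\<And>x. x \<in> {0..L} \<Longrightarrow> m x \<le> B1" using bdd[OF assms(2)] by blast
  obtain B2 where B2: "\<And>x. x \<in> {0..L} \<Longrightarrow> t * n x \<le> B2"
    using bdd[OF continuous_on_mult[OF continuous_on_const assms(3)], of t] by blast
  interpret two_phase L m n t "min c1 (t * c2)" "max B1 B2"
  proof
    fix x assume x: "x \<in> {0..L}"
    show "min c1 (t * c2) \<le> m x \<and> m x \<le> max B1 B2"
      using c1(2)[OF x] B1[OF x] by auto
    have "t * c2 \<le> t * n x" using c2(2)[OF x] assms(6) by (intro mult_left_mono) auto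
    then show "min c1 (t * c2) \<le> t * n x \<and> t * n x \<le> max B1 B2"
      using B2[OF x] by auto
  qed (use assms c1 c2 in auto)
  let ?h = "\<lambda>x. inverse (m x powr (-1/2) + (n x * t) powr (-1/2))"
  let ?I = "integral {0..L} mean_speed"
  have "integral {0..L} mean_speed = integral {0..L} (\<lambda>x. 2 * ?h x)"
  proof (rule integral_cong)
    fix x assume x: "x \<in> {0..L}"
    have pw: "a powr (-1/2) = 1 / sqrt a" if "0 < a" for a :: real
      using that powr_minus_divide[of a "1/2"] by (simp add: powr_half_sqrt)
    have pos: "0 < m x" "0 < n x * t" using sqrt_pos[OF x] by (simp_all add: mult.commute)
    show "mean_speed x = 2 * ?h x"
      unfolding mean_speed_def pw[OF pos(1)] pw[OF pos(2)] mult.commute[of t "n x"]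
      by (rule divide_inverse)
  qed
  then have I: "?I = 2 * integral {0..L} ?h" by simp
  let ?T = "\<lambda>\<alpha> s. (angle \<alpha> s L - \<alpha>) / pi"
  have quot: "((\<lambda>s. real (nat \<lfloor>?T \<alpha> s\<rfloor>) / s) \<longlongrightarrow> ?I / pi) at_top" if \<alpha>: "0 \<le> \<alpha>" for \<alpha>
  proof -
    have "((\<lambda>s. (real (nat \<lfloor>?T \<alpha> s\<rfloor>) - ?T \<alpha> s) / s) \<longlongrightarrow> 0) at_top"
    proof (rule tendsto_0_le[where K = 1 and f = "\<lambda>s. inverse s"])
      show "(inverse \<longlongrightarrow> 0) (at_top :: real filter)"
        by (rule tendsto_inverse_0_at_top[OF filterlim_ident])
      show "\<forall>\<^sub>F s in at_top. norm ((real (nat \<lfloor>?T \<alpha> s\<rfloor>) - ?T \<alpha> s) / s) \<le> norm (inverse s) * 1"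
        using eventually_gt_at_top[of 0]
      proof eventually_elim
        case (elim s)
        have "0 \<le> ?T \<alpha> s"
          using angle_less[OF elim, of 0 L \<alpha>] assms(1) by (simp add: angle_0[OF elim])
        then have "\<bar>real (nat \<lfloor>?T \<alpha> s\<rfloor>) - ?T \<alpha> s\<bar> \<le> 1" by (rule abs_nat_floor_diff_le)
        then show ?case using elim by (simp add: divide_inverse abs_mult mult_left_le_one_le)
      qed
    qed
    moreover have "((\<lambda>s. (angle \<alpha> s L - \<alpha>) / s / pi) \<longlongrightarrow> ?I / pi) at_top"
      by (intro tendsto_divide angle_increment_asymptotics \<alpha> tendsto_const) auto
    ultimately have "((\<lambda>s. (real (nat \<lfloor>?T \<alpha> s\<rfloor>) - ?T \<alpha> s) / s + (angle \<alpha> s L - \<alpha>) / s / pi)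
        \<longlongrightarrow> 0 + ?I / pi) at_top"
      by (rule tendsto_add)
    moreover have "(real (nat \<lfloor>?T \<alpha> s\<rfloor>) - ?T \<alpha> s) / s + (angle \<alpha> s L - \<alpha>) / s / pi
        = real (nat \<lfloor>?T \<alpha> s\<rfloor>) / s" for s
      by (simp add: diff_divide_distrib)
    ultimately show ?thesis by simp
  qed
  have "((\<lambda>s. real (nat \<lfloor>?T 0 s\<rfloor>) / s + real (nat \<lfloor>?T pi s\<rfloor>) / s - 2 * ?I / pi)
      \<longlongrightarrow> ?I / pi + ?I / pi - 2 * ?I / pi) at_top"
    by (intro tendsto_diff tendsto_add quot tendsto_const) auto
  then have "((\<lambda>s. real (nat \<lfloor>?T 0 s\<rfloor>) / s + real (nat \<lfloor>?T pi s\<rfloor>) / s - 2 * ?I / pi)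
      \<longlongrightarrow> 0) at_top"
    by simp
  then have "((\<lambda>\<mu>. real (nat \<lfloor>?T 0 (sqrt \<mu>)\<rfloor>) / sqrt \<mu>
      + real (nat \<lfloor>?T pi (sqrt \<mu>)\<rfloor>) / sqrt \<mu> - 2 * ?I / pi) \<longlongrightarrow> 0) at_top"
    by (rule filterlim_compose[OF _ sqrt_at_top])
  moreover have "\<forall>\<^sub>F \<mu> in at_top.
      real (nat \<lfloor>?T 0 (sqrt \<mu>)\<rfloor>) / sqrt \<mu> + real (nat \<lfloor>?T pi (sqrt \<mu>)\<rfloor>) / sqrt \<mu> - 2 * ?I / pi
      = (real (counting_fun L m n t \<mu>) - 4 * sqrt \<mu> / pi * integral {0..L} ?h) / sqrt \<mu>"
    using eventually_gt_at_top[of 0]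
  proof eventually_elim
    case (elim \<mu>)
    then show ?case
      by (simp add: counting_fun_eq I diff_divide_distrib add_divide_distrib)
  qed
  ultimately have "((\<lambda>\<mu>. (real (counting_fun L m n t \<mu>) - 4 * sqrt \<mu> / pi * integral {0..L} ?h)
      / sqrt \<mu>) \<longlongrightarrow> 0) at_top"
    by (rule Lim_transform_eventually)
  then show ?thesis
    by (rule smalloI_tendsto)
      (use eventually_gt_at_top[of "0 :: real"] in \<open>auto elim: eventually_mono\<close>)
qed

end
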